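(* 1) Let $f,d>0$ be real, let $a,b,c$ be complex with $\operatorname{Re}(c-a-b)>0$ and $c$ not a non-positive integer, and let $j\ge 0$ be an integer. Then $$\int_0^1{}_2F_1(a,b;c;x)\,K_j(x|f,d)\,f(x|f,d)\,dx=\frac{(f)^{(j)}(d)^{(j)}(a)^{(j)}(b)^{(j)}}{j!\,(f+d)^{(2j)}(c)^{(j)}}\;{}_3F_2(a+j,b+j,f+j;\,c+j,d+f+2j;\,1).$$ 2) In particular, if $c=f$ is positive (so $c,d>0$, $\operatorname{Re}(c-a-b)>0$) and neither $c+d-a$ nor $c+d-b$ is a non-positive integer, then $$\int_0^1{}_2F_1(a,b;c;x)\,K_j(x|c,d)\,f(x|c,d)\,dx=\frac{(d)^{(j)}(a)^{(j)}(b)^{(j)}}{j!\,(d+c-a)^{(j)}(d+c-b)^{(j)}}\cdot\frac{\Gamma(c+d)\Gamma(d+c-a-b)}{\Gamma(d+c-a)\Gamma(d+c-b)}.$$ 3) Let $a,b,c,d$ be complex with $\operatorname{Re}(c-a-b)>0$, such that none of $c$, $c+d$, $c+d-a$, $c+d-b$, $c+d-a-b$ is a non-positive integer. Then $$\frac{\Gamma(c)\Gamma(c-a-b)\Gamma(c+d-a)\Gamma(c+d-b)}{\Gamma(c-a)\Gamma(c-b)\Gamma(c+d)\Gamma(c+d-a-b)}={}_4F_3\left(\begin{array}{cccc}a&b&d&c+d-1\\ c&c+d-a&c+d-b&\end{array};1\right)$$ $$+\frac{2abd}{c(c+d-a)(c+d-b)}\;{}_4F_3\left(\begin{array}{cccc}a+1&b+1&d+1&c+d\\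 c+1&c+d-a+1&c+d-b+1&\end{array};1\right),$$ and, if moreover $\operatorname{Re}(c+d-2a-2b)>0$, $$\frac{\Gamma(c+d-a)\Gamma(c+d-b)}{\Gamma(c+d)\Gamma(c+d-a-b)}={}_3F_2\left(\begin{array}{ccc}a&b&c+d-1\\ c+d-a&c+d-b&\end{array};-1\right)$$ $$-\frac{2ab}{(c+d-a)(c+d-b)}\;{}_3F_2\left(\begin{array}{ccc}a+1&b+1&c+d\\ c+d-a+1&c+d-b+1&\end{array};-1\right).$$ 4) Let $n,m\ge 0$ be integers and let $a,b,c$ be complex with $\operatorname{Re}(c-a-b)>0$, such that $c$ is not an integer $\le n+m$ and neither $a$ nor $b$ is an integer $k$ with $-n+1\le k\le n+m$. Then $${}_3F_2\left(\begin{array}{ccc}a+n&b+n&1+n\\ c+n&1+m+2n&\end{array};1\right)=\frac{(2n+m)!\,(c)^{(n)}}{n!\,(a)^{(n)}(b)^{(n)}}\sum_{j=0}^n(-1)^j\binom{n}{j}\frac{(n+m)^{(j)}(c-j-m)^{(j+m)}}{(a-j-m)^{(j+m)}(b-j-m)^{(j+m)}}$$ $$\times\left(\frac{\Gamma(c-j-m)\Gamma(c-a-b+m+j)}{\Gamma(c-a)\Gamma(c-b)}-\sum_{k=0}^{j+m-1}\frac{(a-m-j)^{(k)}(b-m-j)^{(k)}}{k!\,(c-m-j)^{(k)}}\right).$$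
   Context: Rising factorial: $(x)^{(n)}=x(x+1)\cdots(x+n-1)$, $(x)^{(0)}=1$. Generalized hypergeometric function: ${}_nF_m\left(\begin{array}{ccc} a_1&\ldots&a_n\\ b_1&\ldots&b_m\end{array};x\right)={}_nF_m(a_1,\ldots,a_n;b_1,\ldots,b_m;x)=\sum_{j\ge 0}\frac{\prod_{k=1}^n (a_k)^{(j)}}{\prod_{k=1}^m (b_k)^{(j)}}\frac{x^j}{j!}$. The Beta density on $[0,1]$ with parameters $p,q>0$ is $f(x|p,q)=x^{p-1}(1-x)^{q-1}/B(p,q)$ with $B$ Euler's beta function (the symbol $f$ with arguments $(x|\cdot,\cdot)$ denotes this density, while $f$ alone denotes a positive real parameter). Jacobi-type polynomials: $$K_n(x|a,b)=\frac{1}{n!}\sum_{m=0}^n\binom{n}{m}(a+b+n-1)^{(m)}(b+m)^{(n-m)}(x-1)^m.$$ Empty sums are $0$; reciprocal gamma values at poles are understood as $1/\Gamma=0$. *)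

theory Defs
  imports "HOL-Analysis.Analysis"
begin

text \<open>
  The generalized hypergeometric function is the value of the library's formal hypergeometric
  series (whose last argument is the scaling of the variable); the lemma below is the usual
  series.  Rising factorials are \<^const>\<open>pochhammer\<close>.
\<close>

definition hypergeom :: "complex list \<Rightarrow> complex list \<Rightarrow> complex \<Rightarrow> complex" where
  "hypergeom as bs x = eval_fps (fps_hypergeo as bs 1) x"

lemma hypergeom_altdef:
  "hypergeom as bs x =
     (\<Sum>j. (\<Prod>a\<leftarrow>as. pochhammer a j) / (\<Prod>b\<leftarrow>bs. pochhammer b j) * x ^ j / fact j)"
proof -
  have "foldl (\<lambda>r a. r * pochhammer a j) v cs = v * (\<Prod>a\<leftarrow>cs. pochhammer a j)"
    for v :: complex and cs j
    by (induction cs arbitrary: v) (simp_all add: mult.assoc)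
  then show ?thesis
    by (simp add: hypergeom_def eval_fps_def)
qed

text \<open>
  As \<^prop>\<open>(0::real) powr 0 = 0\<close>, the value at an endpoint may differ from the usual one for
  \<open>p = 1\<close> or \<open>q = 1\<close>; this does not affect integrals.
\<close>

definition beta_density :: "real \<Rightarrow> real \<Rightarrow> real \<Rightarrow> real" where
  "beta_density p q x = x powr (p - 1) * (1 - x) powr (q - 1) / Beta p q"

definition jacobi_K :: "nat \<Rightarrow> real \<Rightarrow> real \<Rightarrow> real \<Rightarrow> real" where
  "jacobi_K n a b x = 1 / fact n *
     (\<Sum>m=0..n. of_nat (n choose m) * pochhammer (a + b + of_nat n - 1) m *
        pochhammer (b + of_nat m) (n - m) * (x - 1) ^ m)"

end

theory Submission
  imports Defs "HOL-Library.Landau_Symbols"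
begin

text \<open>
  The three closed forms involved (Gauss's value of \<open>2F1\<close> at \<open>1\<close>, Dougall's very well poised \<open>5F4\<close>
  at \<open>1\<close>, and its limit, a very well poised \<open>4F3\<close> at \<open>-1\<close>) have the same proof.  A telescoping
  (WZ) certificate relates the series to the one with all lower parameters (and, for the well poised
  series, the leading upper one) raised by \<open>1\<close>; after
  \<open>n\<close> such steps the series tends to \<open>1\<close> by dominated convergence, and the accumulated quotient
  of Pochhammer symbols tends to a quotient of Gamma functions.  The pairs of hypergeometric series
  in part 3 are the very well poised series, with the factor \<open>(A + 2j)/A\<close>, \<open>A = c + d - 1\<close>, split
  as \<open>1 + 2j/A\<close>, so that \<open>A = 0\<close> is allowed.

  Parts 1 and 4 rest on one Chu--Vandermonde sum.  It evaluates the moments of \<open>K\<^sub>j\<close> against the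
  Beta density, which vanish below order \<open>j\<close>; and it expands the falling factorial \<open>N(N-1)...(N-n+1)\<close>
  so that the \<open>3F2\<close> of part 4 becomes a combination of Gauss series without their initial terms.
\<close>

subsection \<open>Growth of hypergeometric coefficients\<close>

text \<open>\<open>rGamma_series z n\<close> is \<open>pochhammer z (n + 1)\<close> over
  \<open>fact n\<close> and the \<open>z\<close>-th power of \<open>n\<close>. Dividing it by
  \<open>(z + n) / n\<close>, which tends to 1, removes the last factor and lowers the exponent of
  \<open>n\<close> by 1.\<close>

lemma pochhammer_asymptotics:
  fixes z :: complex
  shows "(\<lambda>n. pochhammer z n / (fact n * of_nat n powr (z - 1))) \<longlonglongrightarrow> rGamma z"
proof -
  have "(\<lambda>n. z * inverse (of_nat n) + 1) \<longlonglongrightarrow> z * 0 + 1"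
    by (intro tendsto_intros lim_inverse_n)
  from tendsto_divide[OF rGamma_series_LIMSEQ[of z] this]
  have "(\<lambda>n. rGamma_series z n / (z * inverse (of_nat n) + 1)) \<longlonglongrightarrow> rGamma z"
    by simp
  moreover have "eventually (\<lambda>n. rGamma_series z n / (z * inverse (of_nat n) + 1)
                   = pochhammer z n / (fact n * of_nat n powr (z - 1))) sequentially"
  proof (rule eventually_sequentiallyI)
    \<comment> \<open>Such an \<open>n\<close> exceeds \<open>norm z\<close>, so
      \<open>z + n\<close> cannot vanish.\<close>
    fix n :: nat assume n: "n \<ge> nat \<lceil>norm z\<rceil> + 1"
    have "z + of_nat n \<noteq> 0"
    proof
      assume "z + of_nat n = 0"
      then have "norm z = of_nat n"
        by (metis add_eq_0_iff norm_minus_cancel norm_of_nat)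
      with n show False by linarith
    qed
    moreover have "exp (z * of_real (ln (of_nat n))) = of_nat n powr (z - 1) * of_nat n"
      using n by (simp add: powr_def ring_distribs exp_diff exp_of_real)
    ultimately show "rGamma_series z n / (z * inverse (of_nat n) + 1)
                   = pochhammer z n / (fact n * of_nat n powr (z - 1))"
      using n by (simp add: rGamma_series_def pochhammer_rec' divide_simps)
  qed
  ultimately show ?thesis
    by (rule Lim_transform_eventually)
qed

lemma norm_pochhammer_asymptotics:
  fixes z :: complex
  shows "(\<lambda>n. norm (pochhammer z n) / (fact n * real n powr (Re z - 1))) \<longlonglongrightarrow> norm (rGamma z)"
proof (rule Lim_transform_eventually[OF tendsto_norm[OF pochhammer_asymptotics]])
  show "eventually (\<lambda>n. norm (pochhammer z n / (fact n * of_nat n powr (z - 1)))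
          = norm (pochhammer z n) / (fact n * real n powr (Re z - 1))) sequentially"
    using eventually_gt_at_top[of 0]
  proof eventually_elim
    case (elim n)
    then have "norm (of_nat n powr (z - 1)) = real n powr (Re z - 1)"
      using norm_powr_real_powr[of "of_nat n" "z - 1"] by simp
    then show ?case by (simp add: norm_divide norm_mult)
  qed
qed

lemma norm_pochhammer_bigo:
  "(\<lambda>n. norm (pochhammer (z::complex) n)) \<in> O(\<lambda>n. fact n * real n powr (Re z - 1))"
  by (rule bigoI_tendsto[OF norm_pochhammer_asymptotics])
     (auto intro!: eventually_sequentiallyI[of 1])

text \<open>Away from the poles of Gamma the limit \<open>rGamma z\<close> is nonzero, so the
  asymptotics also bound from below; denominators need this.\<close>

lemma norm_pochhammer_bigtheta:
  "z \<notin> \<int>\<^sub>\<le>\<^sub>0 \<Longrightarrow> (\<lambda>n. norm (pochhammer (z::complex) n)) \<in> \<Theta>(\<lambda>n. fact n * real n powr (Re z - 1))"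
  by (rule bigthetaI_tendsto[OF _ norm_pochhammer_asymptotics]) (auto simp: rGamma_eq_zero_iff)

text \<open>The power of the variable is left out, so that one estimate serves the arguments 1 and
  -1 and the whole closed unit disc.\<close>

definition hyper_coeff :: "complex list \<Rightarrow> complex list \<Rightarrow> nat \<Rightarrow> complex" where
  "hyper_coeff as bs j =
     (\<Prod>a\<leftarrow>as. pochhammer a j) / (\<Prod>b\<leftarrow>bs. pochhammer b j) / fact j"

lemma hypergeom_conv_hyper_coeff: "hypergeom as bs x = (\<Sum>j. hyper_coeff as bs j * x ^ j)"
  by (simp add: hypergeom_altdef hyper_coeff_def)

lemma hyper_coeff_0 [simp]: "hyper_coeff as bs 0 = 1"
proof -
  have "prod_list (map (\<lambda>_. 1) cs) = (1::complex)" for cs :: "complex list"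
    by (induction cs) auto
  then show ?thesis by (simp add: hyper_coeff_def)
qed

text \<open>The estimates multiply, so the parameters enter only through their number and their
  sum.\<close>

lemma norm_prod_list_pochhammer_bigo:
  "(\<lambda>n. norm (\<Prod>a\<leftarrow>as. pochhammer (a::complex) n)) \<in>
     O(\<lambda>n. fact n ^ length as * real n powr (Re (sum_list as) - length as))"
proof (induction as)
  case Nil
  show ?case by (auto intro!: bigoI_tendsto[of _ _ 1] tendsto_eventually
                        eventually_sequentiallyI[of 1])
next
  case (Cons a as)
  have "(\<lambda>n. (fact n * real n powr (Re a - 1)) *
              (fact n ^ length as * real n powr (Re (sum_list as) - length as)))
        = (\<lambda>n. fact n ^ length (a # as) * real n powr (Re (sum_list (a # as)) - length (a # as)))"
    by (auto simp: fun_eq_iff powr_add [symmetric] algebra_simps)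
  with landau_o.big.mult[OF norm_pochhammer_bigo[of a] Cons.IH] show ?case
    by (simp add: norm_mult)
qed

lemma norm_prod_list_pochhammer_bigtheta:
  assumes "set bs \<inter> \<int>\<^sub>\<le>\<^sub>0 = {}"
  shows "(\<lambda>n. norm (\<Prod>b\<leftarrow>bs. pochhammer (b::complex) n)) \<in>
     \<Theta>(\<lambda>n. fact n ^ length bs * real n powr (Re (sum_list bs) - length bs))"
  using assms
proof (induction bs)
  case Nil
  show ?case by (auto intro!: bigthetaI_tendsto[of 1] tendsto_eventually
                        eventually_sequentiallyI[of 1])
next
  case (Cons a as)
  have "(\<lambda>n. (fact n * real n powr (Re a - 1)) *
              (fact n ^ length as * real n powr (Re (sum_list as) - length as)))
        = (\<lambda>n. fact n ^ length (a # as) * real n powr (Re (sum_list (a # as)) - length (a # as)))"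
    by (auto simp: fun_eq_iff powr_add [symmetric] algebra_simps)
  moreover have "(\<lambda>n. norm (pochhammer a n)) \<in> \<Theta>(\<lambda>n. fact n * real n powr (Re a - 1))"
    using Cons.prems by (intro norm_pochhammer_bigtheta) auto
  from landau_theta.mult[OF this Cons.IH] Cons.prems
  have "(\<lambda>n. norm (pochhammer a n) * norm (\<Prod>b\<leftarrow>as. pochhammer b n)) \<in>
     \<Theta>(\<lambda>n. (fact n * real n powr (Re a - 1)) *
              (fact n ^ length as * real n powr (Re (sum_list as) - length as)))"
    by simp
  ultimately show ?case
    by (simp add: norm_mult)
qed

text \<open>With one more upper than lower parameter, the powers of \<open>fact j\<close> cancel
  against the final division by \<open>fact j\<close>, and the two length terms leave the -1 in the
  exponent.\<close>

lemma hyper_coeff_bigo: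
  assumes "length as = Suc (length bs)" "set bs \<inter> \<int>\<^sub>\<le>\<^sub>0 = {}"
  shows "(\<lambda>j. norm (hyper_coeff as bs j)) \<in> O(\<lambda>j. real j powr (Re (sum_list as - sum_list bs) - 1))"
proof -
  let ?f = "\<lambda>cs n. fact n ^ length cs * real n powr (Re (sum_list cs) - length cs)"
  have "norm (\<Prod>b\<leftarrow>bs. pochhammer b n) \<noteq> 0" for n
  proof -
    have "pochhammer b n \<noteq> 0" if "b \<in> set bs" for b
      using assms(2) that by (fastforce simp: pochhammer_eq_0_iff)
    then have "0 \<notin> set (map (\<lambda>b. pochhammer b n) bs)" by fastforce
    then show ?thesis unfolding norm_eq_zero prod_list_zero_iff .
  qed
  moreover have "eventually (\<lambda>n. ?f bs n \<noteq> 0) sequentially"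
    by (rule eventually_sequentiallyI[of 1]) simp
  moreover have "?f bs \<in> O(\<lambda>n. norm (\<Prod>b\<leftarrow>bs. pochhammer b n))"
    using norm_prod_list_pochhammer_bigtheta[OF assms(2)] by (simp add: bigtheta_def bigomega_iff_bigo)
  ultimately have "(\<lambda>n. norm (\<Prod>a\<leftarrow>as. pochhammer a n) / norm (\<Prod>b\<leftarrow>bs. pochhammer b n))
          \<in> O(\<lambda>n. ?f as n / ?f bs n)"
    by (intro landau_o.big.divide norm_prod_list_pochhammer_bigo) simp_all
  then have "(\<lambda>n. norm (\<Prod>a\<leftarrow>as. pochhammer a n) / norm (\<Prod>b\<leftarrow>bs. pochhammer b n) / fact n)
          \<in> O(\<lambda>n. ?f as n / ?f bs n / fact n)"
    by (intro landau_o.big.divide_right) auto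
  also have "(\<lambda>n. ?f as n / ?f bs n / fact n) \<in> \<Theta>(\<lambda>j. real j powr (Re (sum_list as - sum_list bs) - 1))"
    using assms(1) by (intro bigthetaI_cong eventually_sequentiallyI[of 1])
      (auto simp: powr_diff powr_add divide_simps)
  finally show ?thesis
    by (simp add: hyper_coeff_def norm_divide norm_mult)
qed

text \<open>The exponent in \<open>hyper_coeff_bigo\<close> is then below -1.\<close>

lemma summable_hyper_coeff:
  assumes "length as = Suc (length bs)" "set bs \<inter> \<int>\<^sub>\<le>\<^sub>0 = {}" "Re (sum_list bs - sum_list as) > 0"
  shows "summable (\<lambda>j. norm (hyper_coeff as bs j))"
proof (rule summable_comparison_test_bigo[OF _ hyper_coeff_bigo[OF assms(1,2)]])
  show "summable (\<lambda>j. norm (real j powr (Re (sum_list as - sum_list bs) - 1)))"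
    using assms(3) by (simp add: summable_real_powr_iff)
qed

text \<open>Supplies the vanishing boundary term at infinity when a certificate of the form
  \<open>j\<close> times a coefficient telescopes.\<close>

lemma hyper_coeff_times_n_tendsto_0:
  assumes "length as = Suc (length bs)" "set bs \<inter> \<int>\<^sub>\<le>\<^sub>0 = {}" "Re (sum_list bs - sum_list as) > 0"
  shows "(\<lambda>j. of_nat j * hyper_coeff as bs j) \<longlonglongrightarrow> 0"
proof -
  have "(\<lambda>j. real j * norm (hyper_coeff as bs j)) \<in>
           O(\<lambda>j. real j * real j powr (Re (sum_list as - sum_list bs) - 1))"
    by (intro landau_o.big.mult hyper_coeff_bigo assms) auto
  also have "(\<lambda>j. real j * real j powr (Re (sum_list as - sum_list bs) - 1)) \<in>
               \<Theta>(\<lambda>j. real j powr (Re (sum_list as - sum_list bs)))"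
    by (intro bigthetaI_cong eventually_sequentiallyI[of 1]) (auto simp: powr_diff)
  also have "(\<lambda>j. real j powr (Re (sum_list as - sum_list bs))) \<in> o(\<lambda>_. 1)"
    using assms(3) by (intro smalloI_tendsto) (auto intro!: tendsto_neg_powr filterlim_real_sequentially)
  finally have "(\<lambda>j. norm (of_nat j * hyper_coeff as bs j)) \<longlonglongrightarrow> 0"
    by (auto dest!: smalloD_tendsto simp: norm_mult)
  then show ?thesis
    by (rule tendsto_norm_zero_cancel)
qed

lemma Re_pos_notin_nonpos_Ints: "Re z > 0 \<Longrightarrow> z \<notin> \<int>\<^sub>\<le>\<^sub>0"
  by (auto elim!: nonpos_Ints_cases)

subsection \<open>Limits under shifts of the parameters\<close>

lemma norm_pochhammer_ge:
  fixes w :: complex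
  assumes "M > 0" "Re w \<ge> M"
  shows "pochhammer M j \<le> norm (pochhammer w j)"
proof (induction j)
  case (Suc j)
  have "M + real j \<le> Re (w + of_nat j)" using assms by simp
  also have "\<dots> \<le> norm (w + of_nat j)" by (rule complex_Re_le_cmod)
  finally show ?case
    using Suc assms by (simp add: pochhammer_Suc norm_mult mult_mono pochhammer_nonneg)
qed simp

text \<open>Factor by factor: with \<open>L = norm (x - y)\<close>, the ratio of
  \<open>norm (x + j)\<close> to \<open>norm (y + j)\<close> is at most
  \<open>(1 + L + j) / (1 + j)\<close>. Only \<open>x - y\<close> enters, so the bound survives a
  common shift of \<open>x\<close> and \<open>y\<close>.\<close>

lemma norm_pochhammer_ratio_le:
  fixes x y :: complex
  assumes "Re y \<ge> 1"
  shows "norm (pochhammer x j) * fact j \<le> pochhammer (1 + norm (x - y)) j * norm (pochhammer y j)"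
proof (induction j)
  case (Suc j)
  define L where "L = norm (x - y)"
  have L: "L \<ge> 0" by (simp add: L_def)
  have "1 + real j \<le> Re (y + of_nat j)" using assms by simp
  also have "\<dots> \<le> norm (y + of_nat j)" by (rule complex_Re_le_cmod)
  finally have y: "1 + real j \<le> norm (y + of_nat j)" .
  have "norm (x + of_nat j) = norm ((x - y) + (y + of_nat j))" by simp
  also have "\<dots> \<le> L + norm (y + of_nat j)" unfolding L_def by (rule norm_triangle_ineq)
  finally have "norm (x + of_nat j) * (1 + real j) \<le> (L + norm (y + of_nat j)) * (1 + real j)"
    by (intro mult_right_mono) auto
  \<comment> \<open>After expansion the difference is \<open>L * norm (y + j) - L * (1 + j)\<close>,
    nonnegative because \<open>1 + j\<close> is at most \<open>norm (y + j)\<close>.\<close>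
  also have "\<dots> \<le> (1 + L + real j) * norm (y + of_nat j)"
    using mult_left_mono[OF y L] by (simp add: algebra_simps)
  finally have "norm (x + of_nat j) * (1 + real j) \<le> (1 + L + real j) * norm (y + of_nat j)" .
  with Suc have "(norm (pochhammer x j) * fact j) * (norm (x + of_nat j) * (1 + real j)) \<le>
      (pochhammer (1 + L) j * norm (pochhammer y j)) * ((1 + L + real j) * norm (y + of_nat j))"
    using L by (intro mult_mono[of "norm (pochhammer x j) * fact j"])
      (auto simp: L_def intro!: mult_nonneg_nonneg pochhammer_nonneg add_pos_nonneg)
  then show ?case
    by (simp add: L_def pochhammer_Suc norm_mult mult_ac)
qed simp

text \<open>The bound on the right does not involve the shift, and its series converges once \<open>M\<close> is large.\<close>

lemma hyper_coeff_shift_bound: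
  assumes "M > 0" "Re y \<ge> 1" "\<And>w. w \<in> set ws \<Longrightarrow> Re w \<ge> M"
  shows "norm (hyper_coeff (x # as) (y # ws) j) \<le>
    norm (hyper_coeff (of_real (1 + norm (x - y)) # as) (1 # replicate (length ws) (of_real M)) j)"
proof -
  have L: "norm (pochhammer (complex_of_real (1 + norm (x - y))) j) = pochhammer (1 + norm (x - y)) j"
    by (simp only: pochhammer_of_real norm_of_real)
       (simp add: pochhammer_nonneg add_pos_nonneg)
  have M: "norm (pochhammer (complex_of_real M) j) = pochhammer M j"
    using assms(1) by (simp only: pochhammer_of_real norm_of_real) (simp add: pochhammer_nonneg)
  have M0: "pochhammer M j > 0"
    using assms(1) by (rule pochhammer_pos)
  have "y \<notin> \<int>\<^sub>\<le>\<^sub>0"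
    using assms(2) by (auto elim!: nonpos_Ints_cases)
  then have y0: "norm (pochhammer y j) > 0"
    by (auto simp: pochhammer_eq_0_iff)
  have 1: "norm (pochhammer x j) / norm (pochhammer y j) \<le> pochhammer (1 + norm (x - y)) j / fact j"
    using norm_pochhammer_ratio_le[OF assms(2), of x j] y0 by (simp add: field_simps)
  have "pochhammer M j ^ length ws \<le> norm (\<Prod>w\<leftarrow>ws. pochhammer w j)"
    using assms(3)
  proof (induction ws)
    case (Cons w ws)
    then show ?case
      using norm_pochhammer_ge[OF assms(1), of w j] M0 by (auto simp: norm_mult intro!: mult_mono)
  qed simp
  then have 2: "1 / norm (\<Prod>w\<leftarrow>ws. pochhammer w j) \<le> 1 / pochhammer M j ^ length ws"
    using zero_less_power[OF M0, of "length ws"]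
    by (intro divide_left_mono mult_pos_pos) (auto intro: less_le_trans[rotated] simp del: zero_less_norm_iff zero_less_power_eq)
  have "norm (hyper_coeff (x # as) (y # ws) j) =
    (norm (\<Prod>a\<leftarrow>as. pochhammer a j) / fact j) *
    ((norm (pochhammer x j) / norm (pochhammer y j)) * (1 / norm (\<Prod>w\<leftarrow>ws. pochhammer w j)))"
    by (simp add: hyper_coeff_def norm_mult norm_divide mult_ac)
  also have "\<dots> \<le> (norm (\<Prod>a\<leftarrow>as. pochhammer a j) / fact j) *
    ((pochhammer (1 + norm (x - y)) j / fact j) * (1 / pochhammer M j ^ length ws))"
    by (intro mult_left_mono mult_mono 1 2) (auto intro!: divide_nonneg_nonneg pochhammer_nonneg add_pos_nonneg)
  also have "\<dots> = norm (hyper_coeff (of_real (1 + norm (x - y)) # as) (1 # replicate (length ws) (of_real M)) j)"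
    unfolding hyper_coeff_def
    by (simp add: norm_mult norm_divide L M map_replicate prod_list_replicate norm_power mult_ac
        flip: pochhammer_fact del: of_real_add)
  finally show ?thesis .
qed

text \<open>The shifted pair \<open>x\<close>, \<open>y\<close> has bounded Pochhammer quotients,
  while the further shifted lower parameters \<open>ws\<close> make every coefficient of positive
  index tend to 0. Tannery's theorem then leaves only the constant term.\<close>

lemma hypergeom_shift_tendsto_1:
  fixes x y s :: complex
  assumes len: "length as = Suc (length ws)" and ws: "ws \<noteq> []" and s: "norm s \<le> 1"
  shows "(\<lambda>n. hypergeom ((x + of_nat n) # as) ((y + of_nat n) # map (\<lambda>w. w + of_nat n) ws) s)
           \<longlonglongrightarrow> 1"
proof -
  define l where "l = length ws"
  have l: "l \<ge> 1" using ws by (cases ws) (auto simp: l_def)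
  define T where "T = (\<lambda>j n. hyper_coeff ((x + of_nat n) # as) ((y + of_nat n) # map (\<lambda>w. w + of_nat n) ws) j * s ^ j)"
  \<comment> \<open>\<open>as'\<close> and \<open>bs' M\<close> are the parameters of the majorant
    in \<open>hyper_coeff_shift_bound\<close>; adding \<open>n\<close> to both \<open>x\<close> and
    \<open>y\<close> does not change \<open>norm (x - y)\<close>.\<close>
  define as' where "as' = complex_of_real (1 + norm (x - y)) # as"
  define bs' where "bs' = (\<lambda>M. 1 # replicate l (complex_of_real M))"
  have bound: "eventually (\<lambda>n. \<forall>j. norm (T j n) \<le> norm (hyper_coeff as' (bs' M) j)) sequentially"
    if M: "M > 0" for M
  proof -
    have large: "eventually (\<lambda>n. Re (w + of_nat n) \<ge> R) sequentially" for w R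
    proof (rule eventually_sequentiallyI)
      fix n assume "n \<ge> nat \<lceil>R - Re w\<rceil>"
      then have "R - Re w \<le> real n" by linarith
      then show "Re (w + of_nat n) \<ge> R" by simp
    qed
    have "eventually (\<lambda>n. \<forall>w\<in>set ws. Re (w + of_nat n) \<ge> M) sequentially"
      by (intro eventually_ball_finite) (auto intro: large[simplified])
    then show ?thesis
      using large[where w = y and R = 1]
    proof eventually_elim
      case (elim n)
      show ?case
      proof
        fix j
        have "norm (T j n) \<le> norm (hyper_coeff ((x + of_nat n) # as) ((y + of_nat n) # map (\<lambda>w. w + of_nat n) ws) j) * 1"
          unfolding T_def norm_mult norm_power using s by (intro mult_left_mono power_le_one) auto
        also have "\<dots> \<le> norm (hyper_coeff as' (bs' M) j)"
        proof -
          have "Re w \<ge> M" if "w \<in> set (map (\<lambda>w. w + of_nat n) ws)" for w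
            using elim that by auto
          then have "norm (hyper_coeff ((x + of_nat n) # as) ((y + of_nat n) # map (\<lambda>w. w + of_nat n) ws) j) \<le>
              norm (hyper_coeff (of_real (1 + norm ((x + of_nat n) - (y + of_nat n))) # as)
                (1 # replicate (length (map (\<lambda>w. w + of_nat n) ws)) (of_real M)) j)"
            using M elim(2) by (intro hyper_coeff_shift_bound) auto
          then show ?thesis by (simp add: as'_def bs'_def l_def)
        qed
        finally show "norm (T j n) \<le> norm (hyper_coeff as' (bs' M) j)" .
      qed
    qed
  qed
  \<comment> \<open>The pointwise limit comes from the same majorant: for fixed
    \<open>j >= 1\<close> it is at most \<open>C / M\<close>, and \<open>M\<close> is
    arbitrary.\<close>
  have lim: "(\<lambda>n. T j n) \<longlonglongrightarrow> (if j = 0 then 1 else 0)" for j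
  proof (cases "j = 0")
    case False
    define C where "C = norm ((\<Prod>a\<leftarrow>as'. pochhammer a j) / (pochhammer 1 j * fact j))"
    have ev: "eventually (\<lambda>n. norm (T j n) \<le> C / M) sequentially" if M: "M \<ge> 1" for M
    proof -
      obtain k where k: "j = Suc k" using False by (cases j) auto
      have "1 \<le> pochhammer (M + 1) k"
      proof (induction k)
        case (Suc k)
        have "1 * 1 \<le> pochhammer (M + 1) k * (M + 1 + real k)"
          using M Suc by (intro mult_mono) auto
        then show ?case by (simp add: pochhammer_Suc)
      qed simp
      then have "M \<le> pochhammer M j" using M by (simp add: k pochhammer_rec)
      also have "\<dots> \<le> pochhammer M j ^ l"
        using M calculation l by (intro self_le_power) auto
      finally have "M \<le> pochhammer M j ^ l" .
      moreover have "norm (pochhammer (complex_of_real M) j) = pochhammer M j"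
        using M by (simp only: pochhammer_of_real norm_of_real) (simp add: pochhammer_nonneg)
      then have "norm (hyper_coeff as' (bs' M) j) = C / pochhammer M j ^ l"
        by (simp add: hyper_coeff_def C_def bs'_def norm_mult norm_divide map_replicate
            prod_list_replicate norm_power)
      ultimately have "norm (hyper_coeff as' (bs' M) j) \<le> C / M"
        using M by (auto simp: C_def intro!: divide_left_mono mult_pos_pos)
      with bound[of M] M show ?thesis by (auto elim!: eventually_mono intro: order_trans)
    qed
    have C0: "C \<ge> 0" by (simp add: C_def)
    have "(\<lambda>n. T j n) \<longlonglongrightarrow> 0"
    proof (rule tendstoI)
      fix e :: real assume e: "e > 0"
      have "C / (C / e + 1) < e" using e C0 by (simp add: field_simps)
      with ev[of "C / e + 1"] e C0 show "eventually (\<lambda>n. dist (T j n) 0 < e) sequentially"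
        by (auto elim!: eventually_mono)
    qed
    with False show ?thesis by simp
  qed (simp add: T_def)
  \<comment> \<open>For this \<open>M\<close> the lower parameters of the majorant sum to at least
    \<open>1 + M\<close>, as \<open>l >= 1\<close>, while the upper ones sum to less than
    \<open>M\<close> in real part; so the majorant is summable.\<close>
  define M where "M = norm (sum_list as') + 1"
  have M: "M > 0" by (simp add: M_def add_nonneg_pos)
  have "Re (sum_list (bs' M)) = 1 + real l * M"
    by (simp add: bs'_def sum_list_replicate)
  moreover have "1 * M \<le> real l * M" using l M by (intro mult_right_mono) auto
  moreover have "Re (sum_list as') < M"
    using complex_Re_le_cmod[of "sum_list as'"] by (simp add: M_def)
  moreover have "complex_of_real M \<notin> \<int>\<^sub>\<le>\<^sub>0"
    using M by (intro Re_pos_notin_nonpos_Ints) simp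
  ultimately have "summable (\<lambda>j. norm (hyper_coeff as' (bs' M) j))"
    by (intro summable_hyper_coeff) (auto simp: as'_def bs'_def l_def len)
  moreover have "eventually (\<lambda>(k, n). norm (T k n) \<le> norm (hyper_coeff as' (bs' M) k)) (at_top \<times>\<^sub>F sequentially)"
  proof -
    have "eventually (\<lambda>p. True \<and> (\<forall>j. norm (T j (snd p)) \<le> norm (hyper_coeff as' (bs' M) j)))
            (at_top \<times>\<^sub>F sequentially)"
      using eventually_prodI[OF eventually_True bound[OF M], of at_top] by simp
    then show ?thesis
      by (rule eventually_mono) auto
  qed
  ultimately have "(\<lambda>n. suminf (\<lambda>j. T j n)) \<longlonglongrightarrow> (\<Sum>j. if j = 0 then 1 else 0)"
    by (intro tannerys_theorem[THEN conjunct2, THEN conjunct2] lim) simp_all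
  moreover have "(\<Sum>j. if j = 0 then 1 else 0) = (1::complex)"
    by (rule sums_unique [symmetric]) (rule sums_single[of 0 "\<lambda>_. 1"])
  ultimately show ?thesis
    by (simp add: T_def hypergeom_conv_hyper_coeff)
qed

section \<open>Convergent series, quotients of Pochhammer symbols and iterated recurrences\<close>

lemma hyper_coeff_sums:
  assumes "length as = Suc (length bs)" "set bs \<inter> \<int>\<^sub>\<le>\<^sub>0 = {}" "Re (sum_list bs - sum_list as) > 0"
    and "norm x \<le> 1"
  shows "(\<lambda>j. hyper_coeff as bs j * x ^ j) sums hypergeom as bs x"
proof -
  have "summable (\<lambda>j. hyper_coeff as bs j * x ^ j)"
  proof (rule summable_comparison_test'[OF summable_hyper_coeff[OF assms(1-3)]])
    show "norm (hyper_coeff as bs j * x ^ j) \<le> norm (hyper_coeff as bs j)" for j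
      using assms(4) by (simp add: norm_mult norm_power mult_left_le power_le_one)
  qed
  then show ?thesis
    by (simp add: summable_sums_iff hypergeom_conv_hyper_coeff)
qed

text \<open>Equal lengths cancel the powers of \<open>fact n\<close> in
  \<open>pochhammer_asymptotics\<close>, and equal sums cancel the powers of \<open>n\<close>; only
  the reciprocal Gamma values remain.\<close>

lemma pochhammer_quotient_tendsto:
  fixes zs ws :: "complex list"
  assumes len: "length zs = length ws" and sum: "sum_list zs = sum_list ws"
    and ws: "set ws \<inter> \<int>\<^sub>\<le>\<^sub>0 = {}"
  shows "(\<lambda>n. (\<Prod>z\<leftarrow>zs. pochhammer z n) / (\<Prod>w\<leftarrow>ws. pochhammer w n)) \<longlonglongrightarrow>
           (\<Prod>z\<leftarrow>zs. rGamma z) / (\<Prod>w\<leftarrow>ws. rGamma w)"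
proof -
  have lim: "(\<lambda>n. \<Prod>z\<leftarrow>cs. pochhammer z n / (fact n * of_nat n powr (z - 1))) \<longlonglongrightarrow> (\<Prod>z\<leftarrow>cs. rGamma z)"
    for cs :: "complex list"
  proof (induction cs)
    case (Cons c cs)
    show ?case unfolding list.map prod_list.Cons
      by (intro tendsto_mult pochhammer_asymptotics Cons.IH)
  qed simp
  have nz: "(\<Prod>w\<leftarrow>ws. rGamma w) \<noteq> 0"
    using ws by (auto simp: prod_list_zero_iff rGamma_eq_zero_iff)
  have eq: "(\<Prod>z\<leftarrow>cs. pochhammer z n / (fact n * of_nat n powr (z - 1))) =
     (\<Prod>z\<leftarrow>cs. pochhammer z n) / (fact n ^ length cs * of_nat n powr (sum_list cs - of_nat (length cs)))"
    if "n > 0" for n and cs :: "complex list"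
  proof (induction cs)
    case (Cons z cs)
    have "of_nat n powr (z - 1) * of_nat n powr (sum_list cs - of_nat (length cs)) =
          of_nat n powr (sum_list (z # cs) - of_nat (length (z # cs)))"
      by (simp add: powr_add [symmetric] algebra_simps)
    with Cons.IH show ?case by (simp add: mult_ac)
  qed (use that in auto)
  show ?thesis
  proof (rule Lim_transform_eventually[OF tendsto_divide[OF lim[of zs] lim[of ws] nz]])
    show "eventually (\<lambda>n. (\<Prod>z\<leftarrow>zs. pochhammer z n / (fact n * of_nat n powr (z - 1))) /
             (\<Prod>z\<leftarrow>ws. pochhammer z n / (fact n * of_nat n powr (z - 1))) =
             (\<Prod>z\<leftarrow>zs. pochhammer z n) / (\<Prod>w\<leftarrow>ws. pochhammer w n)) sequentially"
    proof (rule eventually_sequentiallyI)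
      fix n :: nat assume "n \<ge> 1"
      then show "(\<Prod>z\<leftarrow>zs. pochhammer z n / (fact n * of_nat n powr (z - 1))) /
             (\<Prod>z\<leftarrow>ws. pochhammer z n / (fact n * of_nat n powr (z - 1))) =
             (\<Prod>z\<leftarrow>zs. pochhammer z n) / (\<Prod>w\<leftarrow>ws. pochhammer w n)"
        by (subst (1 2) eq) (auto simp: len sum)
    qed
  qed
qed

text \<open>Iteration writes \<open>S 0 / S n\<close> as a quotient of two products, and
  \<open>S n\<close> tends to 1, so that division by \<open>S n\<close> is possible for large
  \<open>n\<close>. The factors \<open>q n\<close> may vanish; this is where zeros of the closed
  forms come from.\<close>

lemma recurrence_limit:
  fixes S :: "nat \<Rightarrow> complex"
  assumes S: "S \<longlonglongrightarrow> 1" and rec: "\<And>n. p n * S n = q n * S (Suc n)" and p: "\<And>n. p n \<noteq> 0"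
  shows "(\<lambda>n. (\<Prod>k<n. q k) / (\<Prod>k<n. p k)) \<longlonglongrightarrow> S 0"
proof -
  have "S 0 * (\<Prod>k<n. p k) = (\<Prod>k<n. q k) * S n" for n
  proof (induction n)
    case (Suc n)
    have "S 0 * (\<Prod>k<Suc n. p k) = (S 0 * (\<Prod>k<n. p k)) * p n" by simp
    also have "\<dots> = (\<Prod>k<n. q k) * (p n * S n)" by (simp only: Suc mult_ac)
    finally show ?case by (simp add: rec)
  qed simp
  then have eq: "S 0 / S n = (\<Prod>k<n. q k) / (\<Prod>k<n. p k)" if "S n \<noteq> 0" for n
    using that p by (simp add: frac_eq_eq)
  have "eventually (\<lambda>n. S n \<noteq> 0) sequentially"
    using S by (rule tendsto_imp_eventually_ne) simp
  then have "eventually (\<lambda>n. S 0 / S n = (\<Prod>k<n. q k) / (\<Prod>k<n. p k)) sequentially"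
    by (rule eventually_mono) (rule eq)
  moreover have "(\<lambda>n. S 0 / S n) \<longlonglongrightarrow> S 0 / 1"
    by (intro tendsto_intros S) simp
  ultimately show ?thesis
    using Lim_transform_eventually by fastforce
qed

lemma add_of_nat_nonpos_Ints: "z + of_nat n \<in> \<int>\<^sub>\<le>\<^sub>0 \<Longrightarrow> (z::complex) \<in> \<int>\<^sub>\<le>\<^sub>0"
  by (metis add_diff_cancel_right' minus_of_nat_in_nonpos_Ints nonpos_Ints_add uminus_add_conv_diff add.commute)

lemma add_of_nat_neq_0: "(z::complex) \<notin> \<int>\<^sub>\<le>\<^sub>0 \<Longrightarrow> z + of_nat n \<noteq> 0"
  by (auto simp: add_eq_0_iff2)

lemma pochhammer_neq_0: "(z::complex) \<notin> \<int>\<^sub>\<le>\<^sub>0 \<Longrightarrow> pochhammer z n \<noteq> 0"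
  by (auto simp: pochhammer_eq_0_iff)

lemma pochhammer_plus_1: "(z::complex) * pochhammer (z + 1) n = pochhammer z n * (z + of_nat n)"
  by (metis pochhammer_rec pochhammer_Suc)

subsection \<open>Gauss's theorem and Dougall's sums\<close>

text \<open>The certificate is \<open>G j = - c * j * t j\<close>, with \<open>t\<close> the
  coefficients of the first series. Its differences are the termwise difference of the two sides; it
  vanishes at 0 and tends to 0, so the sums agree.\<close>

lemma gauss_contiguous:
  fixes a b c :: complex
  assumes re: "Re (c - a - b) > 0" and c: "c \<notin> \<int>\<^sub>\<le>\<^sub>0"
  shows "(c * (c - a - b)) * hypergeom [a, b] [c] 1 = ((c - a) * (c - b)) * hypergeom [a, b] [c + 1] 1"
proof -
  have c1: "c + 1 \<notin> \<int>\<^sub>\<le>\<^sub>0" using c add_of_nat_nonpos_Ints[of c 1] by auto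
  let ?t = "hyper_coeff [a, b] [c]" and ?u = "hyper_coeff [a, b] [c + 1]"
  define G where "G = (\<lambda>j. - c * (of_nat j * ?t j))"
  have "G \<longlonglongrightarrow> - c * 0"
    unfolding G_def using re c
    by (intro tendsto_mult tendsto_const hyper_coeff_times_n_tendsto_0) auto
  then have "(\<lambda>j. G (Suc j) - G j) sums (0 - G 0)"
    by (intro telescope_sums) simp
  \<comment> \<open>Relative to \<open>?t j\<close> this is a rational identity in \<open>j\<close>
    whose only denominator is \<open>c + j\<close>.\<close>
  moreover have "G (Suc j) - G j = (c * (c - a - b)) * ?t j - ((c - a) * (c - b)) * ?u j" for j
  proof -
    have cj: "c + of_nat j \<noteq> 0" by (rule add_of_nat_neq_0[OF c])
    have c0: "c \<noteq> 0" "pochhammer c j \<noteq> 0" using c by (auto simp: pochhammer_neq_0)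
    have "pochhammer (c + 1) j = pochhammer c j * (c + of_nat j) / c"
      using pochhammer_plus_1[of c j] c0 by (simp add: field_simps)
    then have u: "?u j = ?t j * c / (c + of_nat j)"
      by (simp add: hyper_coeff_def)
    have "of_nat (Suc j) * ?t (Suc j) = ?t j * (a + of_nat j) * (b + of_nat j) / (c + of_nat j)"
      by (simp add: hyper_coeff_def pochhammer_Suc mult_ac del: of_nat_Suc)
    then show ?thesis
      unfolding G_def u using cj by (simp add: field_simps del: of_nat_Suc)
  qed
  ultimately have "(\<lambda>j. (c * (c - a - b)) * ?t j - ((c - a) * (c - b)) * ?u j) sums 0"
    by (simp add: G_def)
  moreover have "(\<lambda>j. (c * (c - a - b)) * ?t j - ((c - a) * (c - b)) * ?u j) sums
     ((c * (c - a - b)) * hypergeom [a, b] [c] 1 - ((c - a) * (c - b)) * hypergeom [a, b] [c + 1] 1)"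
    using hyper_coeff_sums[of "[a, b]" "[c]" 1] hyper_coeff_sums[of "[a, b]" "[c + 1]" 1] re c c1
    by (intro sums_diff sums_mult) auto
  ultimately show ?thesis
    using sums_unique2 by fastforce
qed

text \<open>Iterating \<open>gauss_contiguous\<close> in \<open>c\<close> drives the series to 1.
  The accumulated Pochhammer symbols balance: \<open>c - a\<close> and \<open>c - b\<close> have the
  same sum as \<open>c\<close> and \<open>c - a - b\<close>.\<close>

theorem gauss_hypergeom:
  fixes a b c :: complex
  assumes re: "Re (c - a - b) > 0" and c: "c \<notin> \<int>\<^sub>\<le>\<^sub>0"
  shows "hypergeom [a, b] [c] 1 = Gamma c * Gamma (c - a - b) * rGamma (c - a) * rGamma (c - b)"
proof -
  define S where "S = (\<lambda>n. hypergeom [a, b] [c + of_nat n] 1)"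
  have cn: "c + of_nat n \<notin> \<int>\<^sub>\<le>\<^sub>0" for n using c add_of_nat_nonpos_Ints by blast
  have cab: "c - a - b \<notin> \<int>\<^sub>\<le>\<^sub>0" using re by (rule Re_pos_notin_nonpos_Ints)
  \<comment> \<open>A cancelling parameter \<open>1 + n\<close> is inserted above and below, since
    the shift lemma expects a pair of parameters moving together besides the moving
    \<open>c\<close>.\<close>
  have "S = (\<lambda>n. hypergeom [1 + of_nat n, a, b] [1 + of_nat n, c + of_nat n] 1)"
  proof
    fix n
    have "1 + complex_of_nat n \<notin> \<int>\<^sub>\<le>\<^sub>0" by (intro Re_pos_notin_nonpos_Ints) simp
    then have "hyper_coeff [1 + of_nat n, a, b] [1 + of_nat n, c + of_nat n] = hyper_coeff [a, b] [c + of_nat n]"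
      by (auto simp: fun_eq_iff hyper_coeff_def dest: pochhammer_neq_0)
    then show "S n = hypergeom [1 + of_nat n, a, b] [1 + of_nat n, c + of_nat n] 1"
      by (simp add: S_def hypergeom_conv_hyper_coeff)
  qed
  then have "S \<longlonglongrightarrow> 1"
    using hypergeom_shift_tendsto_1[of "[a, b]" "[c]" 1 1 1] by simp
  moreover have "((c + of_nat n) * (c - a - b + of_nat n)) * S n =
       ((c - a + of_nat n) * (c - b + of_nat n)) * S (Suc n)" for n
    using gauss_contiguous[of "c + of_nat n" a b] re cn by (simp add: S_def algebra_simps)
  ultimately have "(\<lambda>n. (\<Prod>k<n. (c - a + of_nat k) * (c - b + of_nat k)) /
      (\<Prod>k<n. (c + of_nat k) * (c - a - b + of_nat k))) \<longlonglongrightarrow> S 0"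
    using add_of_nat_neq_0[OF c] add_of_nat_neq_0[OF cab] by (intro recurrence_limit) auto
  moreover have "(\<lambda>n. (\<Prod>k<n. (c - a + of_nat k) * (c - b + of_nat k)) /
      (\<Prod>k<n. (c + of_nat k) * (c - a - b + of_nat k))) \<longlonglongrightarrow>
      (rGamma (c - a) * rGamma (c - b)) / (rGamma c * rGamma (c - a - b))"
    using pochhammer_quotient_tendsto[of "[c - a, c - b]" "[c, c - a - b]"] c cab
    by (simp add: pochhammer_prod prod.distrib atLeast0LessThan)
  ultimately have "S 0 = (rGamma (c - a) * rGamma (c - b)) / (rGamma c * rGamma (c - a - b))"
    by (rule LIMSEQ_unique)
  then show ?thesis
    by (simp add: S_def Gamma_def field_simps)
qed

section \<open>The very well poised \<open>5F4\<close> at 1\<close>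

lemma hyper_coeff_tendsto_0:
  assumes "length as = Suc (length bs)" "set bs \<inter> \<int>\<^sub>\<le>\<^sub>0 = {}" "Re (sum_list bs - sum_list as) > 0"
  shows "hyper_coeff as bs \<longlonglongrightarrow> 0"
  using summable_LIMSEQ_zero[OF summable_hyper_coeff[OF assms]] by (simp add: tendsto_norm_zero_iff)

lemma pochhammer_shift:
  fixes z :: complex
  assumes "z \<notin> \<int>\<^sub>\<le>\<^sub>0"
  shows "pochhammer (z + 1) n = pochhammer z n * (z + of_nat n) / z"
proof -
  have "z \<noteq> 0" using assms by auto
  then show ?thesis using pochhammer_plus_1[of z n] by (simp add: eq_divide_eq mult.commute)
qed

text \<open>For \<open>j >= 1\<close> this turns
  \<open>pochhammer (e - 1) j + 2 * j * pochhammer e (j - 1)\<close> into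
  \<open>(e - 1 + 2 * j) * pochhammer e (j - 1)\<close> without a division by
  \<open>e - 1\<close>.\<close>

lemma pochhammer_minus_1_Suc: "pochhammer (z - 1) (Suc k) = (z - 1) * pochhammer (z::complex) k"
  by (simp add: pochhammer_rec)

lemma add_1_notin_nonpos_Ints: "z \<notin> \<int>\<^sub>\<le>\<^sub>0 \<Longrightarrow> (z::complex) + 1 \<notin> \<int>\<^sub>\<le>\<^sub>0"
  using add_of_nat_nonpos_Ints[of z 1] by auto

text \<open>The parameters are ordered for \<open>hypergeom_shift_tendsto_1\<close>: the first upper
  and the first lower one move together with \<open>c\<close>, the other upper ones stay
  fixed.\<close>

definition dougall_sum :: "complex \<Rightarrow> complex \<Rightarrow> complex \<Rightarrow> complex \<Rightarrow> complex" where
  "dougall_sum a b d c =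
     hypergeom [c + d - 1, a, b, d] [c + d - a, c, c + d - b] 1
     + 2 * a * b * d / (c * (c + d - a) * (c + d - b))
       * hypergeom [c + d, a + 1, b + 1, d + 1] [c + d - a + 1, c + 1, c + d - b + 1] 1"

text \<open>The certificate is \<open>G j = - (j + r) * C * w c e j\<close>, where \<open>w\<close>
  is the \<open>j\<close>-weighted term of the very well poised series. As \<open>d\<close> stays
  fixed, \<open>e = c + d\<close> is raised together with \<open>c\<close>.\<close>

lemma dougall_sum_contiguous:
  fixes a b c d :: complex
  assumes re: "Re (c - a - b) > 0"
    and nonpos: "c \<notin> \<int>\<^sub>\<le>\<^sub>0" "c + d \<notin> \<int>\<^sub>\<le>\<^sub>0" "c + d - a \<notin> \<int>\<^sub>\<le>\<^sub>0" "c + d - b \<notin> \<int>\<^sub>\<le>\<^sub>0"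
  shows "(c * (c - a - b) * (c + d - a) * (c + d - b)) * dougall_sum a b d c =
         ((c - a) * (c - b) * (c + d) * (c + d - a - b)) * dougall_sum a b d (c + 1)"
proof -
  define e where "e = c + d"
  define h1 h2 where "h1 = (\<lambda>c e. hyper_coeff [e - 1, a, b, d] [e - a, c, e - b])"
    and "h2 = (\<lambda>c e. hyper_coeff [e, a + 1, b + 1, d + 1] [e - a + 1, c + 1, e - b + 1])"
  \<comment> \<open>The factor common to both series: every Pochhammer symbol except the leading
    upper one.\<close>
  define Y where "Y = (\<lambda>c e j. pochhammer a j * pochhammer b j * pochhammer d j /
                        (fact j * pochhammer c j * pochhammer (e - a) j * pochhammer (e - b) j))"
  \<comment> \<open>The truncated \<open>j - 1\<close> is harmless at \<open>j = 0\<close>, where \<open>w\<close> vanishes.\<close>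
  define w where "w = (\<lambda>c e j. of_nat j * pochhammer e (j - 1) * Y c e j)"
  define C where "C = c * (e - a) * (e - b)"
  define X where "X = a * b * d / (c * (e - a) * (e - b))"
  define r where "r = c + e - a - b - 1"
  define G where "G = (\<lambda>j. - (of_nat j + r) * C * w c e j)"
  have e: "e \<notin> \<int>\<^sub>\<le>\<^sub>0" "e - a \<notin> \<int>\<^sub>\<le>\<^sub>0" "e - b \<notin> \<int>\<^sub>\<le>\<^sub>0" using nonpos by (auto simp: e_def)
  note nonpos' = nonpos(1) e
  have nonpos1: "c + 1 \<notin> \<int>\<^sub>\<le>\<^sub>0" "e + 1 \<notin> \<int>\<^sub>\<le>\<^sub>0" "e + 1 - a \<notin> \<int>\<^sub>\<le>\<^sub>0" "e + 1 - b \<notin> \<int>\<^sub>\<le>\<^sub>0"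
    using nonpos'[THEN add_1_notin_nonpos_Ints] by (simp_all add: algebra_simps)
  \<comment> \<open>The second series of \<open>dougall_sum\<close> is the sum of the
    \<open>w\<close> terms reindexed from 1, which is why all its parameters are raised by
    1.\<close>
  have w_Suc: "w c e (Suc k) = a * b * d / (c * (e - a) * (e - b)) * h2 c e k" for c e k
    by (simp add: w_def Y_def h2_def hyper_coeff_def pochhammer_rec mult_ac del: of_nat_Suc)
  have w_0: "w c e 0 = 0" for c e
    by (simp add: w_def)
  have sums: "(\<lambda>j. h1 c e j + 2 * w c e j) sums dougall_sum a b d c"
    if e: "e = c + d" and re: "Re (c - a - b) > 0"
      and nonpos: "c \<notin> \<int>\<^sub>\<le>\<^sub>0" "e - a \<notin> \<int>\<^sub>\<le>\<^sub>0" "e - b \<notin> \<int>\<^sub>\<le>\<^sub>0" for c e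
  proof -
    have "h1 c e sums hypergeom [e - 1, a, b, d] [e - a, c, e - b] 1"
      unfolding h1_def using hyper_coeff_sums[of "[e - 1, a, b, d]" "[e - a, c, e - b]" 1] nonpos re
      by (simp add: e)
    moreover have "h2 c e sums hypergeom [e, a + 1, b + 1, d + 1] [e - a + 1, c + 1, e - b + 1] 1"
      unfolding h2_def
      using hyper_coeff_sums[of "[e, a + 1, b + 1, d + 1]" "[e - a + 1, c + 1, e - b + 1]" 1]
        nonpos[THEN add_1_notin_nonpos_Ints] re
      by (simp add: e)
    then have "(\<lambda>k. w c e (Suc k)) sums (a * b * d / (c * (e - a) * (e - b)) *
        hypergeom [e, a + 1, b + 1, d + 1] [e - a + 1, c + 1, e - b + 1] 1)"
      unfolding w_Suc by (rule sums_mult)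
    then have "w c e sums (a * b * d / (c * (e - a) * (e - b)) *
        hypergeom [e, a + 1, b + 1, d + 1] [e - a + 1, c + 1, e - b + 1] 1)"
      using w_0 by (auto dest: sums_Suc)
    ultimately have "(\<lambda>j. h1 c e j + 2 * w c e j) sums
       (hypergeom [e - 1, a, b, d] [e - a, c, e - b] 1 + 2 * (a * b * d / (c * (e - a) * (e - b)) *
        hypergeom [e, a + 1, b + 1, d + 1] [e - a + 1, c + 1, e - b + 1] 1))"
      by (intro sums_add sums_mult)
    then show ?thesis by (simp add: dougall_sum_def e mult_ac)
  qed
  \<comment> \<open>The lower parameters of \<open>h2\<close> exceed the upper ones by
    \<open>2 * (c - a - b)\<close> in sum, so even \<open>k * h2 c e k\<close> tends to 0. This
    covers the linear factor of \<open>G\<close>.\<close>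
  have "(\<lambda>k. (of_nat k * h2 c e k + (1 + r) * h2 c e k)) \<longlonglongrightarrow> 0 + (1 + r) * 0"
    unfolding h2_def using nonpos'[THEN add_1_notin_nonpos_Ints] re
    by (intro tendsto_intros hyper_coeff_times_n_tendsto_0 hyper_coeff_tendsto_0) (auto simp: e_def)
  then have "(\<lambda>k. - C * X * (of_nat k * h2 c e k + (1 + r) * h2 c e k)) \<longlonglongrightarrow> - C * X * 0"
    by (intro tendsto_intros) simp
  moreover have "G (Suc k) = - C * X * (of_nat k * h2 c e k + (1 + r) * h2 c e k)" for k
    unfolding G_def w_Suc X_def [symmetric] by (simp add: algebra_simps)
  ultimately have "(\<lambda>k. G (Suc k)) \<longlonglongrightarrow> 0"
    by simp
  then have "G \<longlonglongrightarrow> 0"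
    by (rule LIMSEQ_imp_Suc)
  then have "(\<lambda>j. G (Suc j) - G j) sums (0 - G 0)"
    by (rule telescope_sums)
  moreover have "G (Suc j) - G j = ((c - a - b) * C) * (h1 c e j + 2 * w c e j) -
     ((c - a) * (c - b) * e * (e - a - b)) * (h1 (c + 1) (e + 1) j + 2 * w (c + 1) (e + 1) j)" for j
  proof (cases j)
    case 0
    have "C \<noteq> 0" using nonpos' by (auto simp: C_def)
    then have "G (Suc 0) - G 0 = - (c + e - a - b) * (a * b * (e - c))"
      by (simp add: G_def w_Suc r_def h2_def) (simp add: w_def C_def e_def)
    also have "\<dots> = (c - a - b) * C - (c - a) * (c - b) * e * (e - a - b)"
      by (simp add: C_def algebra_simps)
    finally show ?thesis using 0 by (simp add: h1_def w_def)
  next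
    case (Suc k)
    define J where "J = complex_of_nat j"
    define E where "E = pochhammer e k"
    define Z where "Z = Y c e j"
    define D where "D = (c + J) * (e - a + J) * (e - b + J)"
    define N where "N = (a + J) * (b + J) * (d + J)"
    have J: "J = of_nat k + 1" by (simp add: J_def Suc)
    have e0: "e \<noteq> 0" using e by auto
    have D: "D \<noteq> 0" unfolding D_def J_def using nonpos'[THEN add_of_nat_neq_0] by simp
    have Yh1: "h1 c e j = pochhammer (e - 1) j * Y c e j" for c e
      by (simp add: h1_def hyper_coeff_def Y_def mult_ac)
    have 1: "h1 c e j + 2 * w c e j = (e - 1 + 2 * J) * E * Z"
      unfolding Yh1 w_def by (simp add: Suc pochhammer_minus_1_Suc E_def Z_def J algebra_simps)
    have "Y (c + 1) (e + 1) j = Z * (C / D)"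
      using nonpos' nonpos1 by (simp add: Y_def Z_def C_def D_def pochhammer_shift J_def
          diff_add_eq [symmetric] mult_ac)
    moreover have "pochhammer (e + 1) k = E * (e + J - 1) / e"
      using e by (simp add: pochhammer_shift E_def J)
    moreover have 5: "h1 (c + 1) (e + 1) j + 2 * w (c + 1) (e + 1) j =
        (e + 2 * J) * pochhammer (e + 1) k * Y (c + 1) (e + 1) j"
      unfolding Yh1 w_def by (simp add: Suc pochhammer_rec [of e] J algebra_simps)
    ultimately have 2: "h1 (c + 1) (e + 1) j + 2 * w (c + 1) (e + 1) j =
        (e + 2 * J) * (E * (e + J - 1) / e) * (Z * (C / D))"
      using 5 by simp
    have 3: "w c e j = J * E * Z"
      by (simp add: w_def Suc E_def Z_def J)
    have "of_nat (Suc j) * Y c e (Suc j) = Z * (N / D)"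
      by (simp add: Y_def Z_def N_def D_def J_def pochhammer_Suc mult_ac del: of_nat_Suc)
    then have 4: "w c e (Suc j) = E * (e + J - 1) * (Z * (N / D))"
      by (simp add: w_def pochhammer_Suc E_def J mult_ac Suc del: of_nat_Suc)
    \<comment> \<open>The certificate equation with the common factor \<open>C * E * Z / D\<close>
      removed: a polynomial identity once \<open>e\<close> is replaced by
      \<open>c + d\<close>.\<close>
    have "(c - a - b) * (e - 1 + 2 * J) * D - (c - a) * (c - b) * (e - a - b) * (e + 2 * J) * (e + J - 1) =
          - (J + 1 + r) * (e + J - 1) * N + (J + r) * J * D"
      unfolding D_def N_def r_def e_def by algebra
    then have "(C * E * Z / D) * ((c - a - b) * (e - 1 + 2 * J) * D -
            (c - a) * (c - b) * (e - a - b) * (e + 2 * J) * (e + J - 1)) =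
          (C * E * Z / D) * (- (J + 1 + r) * (e + J - 1) * N + (J + r) * J * D)"
      by simp
    moreover have "(C * E * Z / D) * ((c - a - b) * (e - 1 + 2 * J) * D -
            (c - a) * (c - b) * (e - a - b) * (e + 2 * J) * (e + J - 1)) =
        ((c - a - b) * C) * ((e - 1 + 2 * J) * E * Z) - ((c - a) * (c - b) * e * (e - a - b)) *
          ((e + 2 * J) * (E * (e + J - 1) / e) * (Z * (C / D)))"
      using D e0 by (simp add: field_simps)
    moreover have "(C * E * Z / D) * (- (J + 1 + r) * (e + J - 1) * N + (J + r) * J * D) =
       - (J + 1 + r) * C * (E * (e + J - 1) * (Z * (N / D))) - - (J + r) * C * (J * E * Z)"
      using D by (simp add: field_simps)
    moreover have "of_nat (Suc j) = J + 1" by (simp add: J_def)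
    ultimately show ?thesis
      unfolding G_def 1 2 unfolding 3 4 by (simp only: J_def)
  qed
  ultimately have "(\<lambda>j. ((c - a - b) * C) * (h1 c e j + 2 * w c e j) -
     ((c - a) * (c - b) * e * (e - a - b)) * (h1 (c + 1) (e + 1) j + 2 * w (c + 1) (e + 1) j)) sums 0"
    by (simp add: G_def w_def)
  moreover have "(\<lambda>j. ((c - a - b) * C) * (h1 c e j + 2 * w c e j) -
     ((c - a) * (c - b) * e * (e - a - b)) * (h1 (c + 1) (e + 1) j + 2 * w (c + 1) (e + 1) j)) sums
     (((c - a - b) * C) * dougall_sum a b d c - ((c - a) * (c - b) * e * (e - a - b)) * dougall_sum a b d (c + 1))"
    using nonpos' nonpos1 re by (intro sums_diff sums_mult sums) (auto simp: e_def)
  ultimately have "((c - a - b) * C) * dougall_sum a b d c - 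
        ((c - a) * (c - b) * e * (e - a - b)) * dougall_sum a b d (c + 1) = 0"
    using sums_unique2 by blast
  then show ?thesis
    by (simp add: C_def e_def mult_ac)
qed

lemma inverse_add_of_nat_tendsto_0: "(\<lambda>n. 1 / ((z::complex) + of_nat n)) \<longlonglongrightarrow> 0"
proof -
  have "filterlim (\<lambda>n. z + of_nat n) at_infinity sequentially"
    by (intro tendsto_add_filterlim_at_infinity[OF tendsto_const] tendsto_of_nat)
  then show ?thesis
    by (intro tendsto_divide_0[OF tendsto_const])
qed

text \<open>Along \<open>c + n\<close> the first series tends to 1, while the coefficient in front
  of the second, with three growing denominators, tends to 0. Then the contiguous relation is
  iterated as for Gauss's theorem.\<close>

theorem dougall_5F4:
  fixes a b c d :: complex
  assumes re: "Re (c - a - b) > 0"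
    and nonpos: "c \<notin> \<int>\<^sub>\<le>\<^sub>0" "c + d \<notin> \<int>\<^sub>\<le>\<^sub>0" "c + d - a \<notin> \<int>\<^sub>\<le>\<^sub>0" "c + d - b \<notin> \<int>\<^sub>\<le>\<^sub>0"
  shows "dougall_sum a b d c = Gamma c * Gamma (c - a - b) * Gamma (c + d - a) * Gamma (c + d - b)
        * rGamma (c - a) * rGamma (c - b) / (Gamma (c + d) * Gamma (c + d - a - b))"
proof -
  define S where "S = (\<lambda>n. dougall_sum a b d (c + of_nat n))"
  have shift: "z \<notin> \<int>\<^sub>\<le>\<^sub>0 \<Longrightarrow> z + of_nat n \<notin> \<int>\<^sub>\<le>\<^sub>0" for z :: complex and n
    using add_of_nat_nonpos_Ints by blast
  have cab: "c - a - b \<notin> \<int>\<^sub>\<le>\<^sub>0" using re by (rule Re_pos_notin_nonpos_Ints)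
  have "S = (\<lambda>n. hypergeom [c + d - 1 + of_nat n, a, b, d] [c + d - a + of_nat n, c + of_nat n, c + d - b + of_nat n] 1
     + 2 * a * b * d * ((1 / (c + of_nat n)) * (1 / (c + d - a + of_nat n)) * (1 / (c + d - b + of_nat n)))
       * hypergeom [c + d + of_nat n, a + 1, b + 1, d + 1]
           [c + d - a + 1 + of_nat n, c + 1 + of_nat n, c + d - b + 1 + of_nat n] 1)"
    by (simp add: S_def dougall_sum_def fun_eq_iff algebra_simps)
  also have "\<dots> \<longlonglongrightarrow> 1 + 2 * a * b * d * (0 * 0 * 0) * 1"
    using hypergeom_shift_tendsto_1[of "[a, b, d]" "[c, c + d - b]" 1 "c + d - 1" "c + d - a"]
      hypergeom_shift_tendsto_1[of "[a + 1, b + 1, d + 1]" "[c + 1, c + d - b + 1]" 1 "c + d" "c + d - a + 1"]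
    by (intro tendsto_intros inverse_add_of_nat_tendsto_0) simp_all
  finally have "S \<longlonglongrightarrow> 1" by simp
  moreover have "((c + of_nat n) * (c - a - b + of_nat n) * (c + d - a + of_nat n) * (c + d - b + of_nat n)) * S n =
       ((c - a + of_nat n) * (c - b + of_nat n) * (c + d + of_nat n) * (c + d - a - b + of_nat n)) * S (Suc n)" for n
  proof -
    have 1: "x + of_nat n - y = x - y + of_nat n" for x y :: complex by simp
    have 2: "x + of_nat n + d = x + d + of_nat n" for x by simp
    have 3: "c + of_nat (Suc n) = c + of_nat n + 1" by simp
    show ?thesis
      using dougall_sum_contiguous[of "c + of_nat n" a b d] re nonpos[THEN shift, of n]
      unfolding S_def 3 by (simp only: 1 2) simp
  qed
  moreover have "(c + of_nat n) * (c - a - b + of_nat n) * (c + d - a + of_nat n) * (c + d - b + of_nat n) \<noteq> 0" for n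
    using nonpos cab by (auto dest: add_of_nat_neq_0[of _ n])
  ultimately have "(\<lambda>n. (\<Prod>k<n. (c - a + of_nat k) * (c - b + of_nat k) * (c + d + of_nat k) * (c + d - a - b + of_nat k)) /
      (\<Prod>k<n. (c + of_nat k) * (c - a - b + of_nat k) * (c + d - a + of_nat k) * (c + d - b + of_nat k))) \<longlonglongrightarrow> S 0"
    by (rule recurrence_limit)
  moreover have "(\<lambda>n. (\<Prod>k<n. (c - a + of_nat k) * (c - b + of_nat k) * (c + d + of_nat k) * (c + d - a - b + of_nat k)) /
      (\<Prod>k<n. (c + of_nat k) * (c - a - b + of_nat k) * (c + d - a + of_nat k) * (c + d - b + of_nat k))) \<longlonglongrightarrow>
      (rGamma (c - a) * rGamma (c - b) * rGamma (c + d) * rGamma (c + d - a - b)) /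
      (rGamma c * rGamma (c - a - b) * rGamma (c + d - a) * rGamma (c + d - b))"
    using pochhammer_quotient_tendsto[of "[c - a, c - b, c + d, c + d - a - b]" "[c, c - a - b, c + d - a, c + d - b]"] nonpos cab
    by (simp add: pochhammer_prod prod.distrib atLeast0LessThan mult.assoc)
  ultimately have "S 0 = (rGamma (c - a) * rGamma (c - b) * rGamma (c + d) * rGamma (c + d - a - b)) /
      (rGamma c * rGamma (c - a - b) * rGamma (c + d - a) * rGamma (c + d - b))"
    by (rule LIMSEQ_unique)
  then show ?thesis
    by (simp add: S_def Gamma_def field_simps)
qed

section \<open>The very well poised \<open>4F3\<close> at -1\<close>

text \<open>Formally \<open>dougall_sum a b d (e - d)\<close> as \<open>d\<close> tends to infinity:
  the quotient of the Pochhammer symbols of \<open>d\<close> and \<open>e - d\<close> of order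
  \<open>j\<close> tends to \<open>(-1) ^ j\<close>, which moves the argument to -1.\<close>

definition alternating_dougall_sum :: "complex \<Rightarrow> complex \<Rightarrow> complex \<Rightarrow> complex" where
  "alternating_dougall_sum a b e =
     hypergeom [e - 1, a, b] [e - a, e - b] (- 1)
     - 2 * a * b / ((e - a) * (e - b))
       * hypergeom [e, a + 1, b + 1] [e - a + 1, e - b + 1] (- 1)"

text \<open>Same scheme as \<open>dougall_sum_contiguous\<close>, with the simpler certificate
  \<open>G j = - C * w e j\<close>, free of a linear factor in \<open>j\<close>.\<close>

lemma alternating_dougall_sum_contiguous:
  fixes a b e :: complex
  assumes re: "Re (e - 2 * a - 2 * b) > 0"
    and nonpos: "e \<notin> \<int>\<^sub>\<le>\<^sub>0" "e - a \<notin> \<int>\<^sub>\<le>\<^sub>0" "e - b \<notin> \<int>\<^sub>\<le>\<^sub>0"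
  shows "((e - a) * (e - b)) * alternating_dougall_sum a b e = (e * (e - a - b)) * alternating_dougall_sum a b (e + 1)"
proof -
  define h1 h2 where "h1 = (\<lambda>e. hyper_coeff [e - 1, a, b] [e - a, e - b])"
    and "h2 = (\<lambda>e. hyper_coeff [e, a + 1, b + 1] [e - a + 1, e - b + 1])"
  \<comment> \<open>Here the sign \<open>(-1) ^ j\<close> is part of the common factor.\<close>
  define Y where "Y = (\<lambda>e j. pochhammer a j * pochhammer b j * (-1) ^ j /
                        (fact j * pochhammer (e - a) j * pochhammer (e - b) j))"
  define w where "w = (\<lambda>e j. of_nat j * pochhammer e (j - 1) * Y e j)"
  define C where "C = (e - a) * (e - b)"
  define X where "X = a * b / ((e - a) * (e - b))"
  define G where "G = (\<lambda>j. - C * w e j)"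
  have nonpos1: "e + 1 \<notin> \<int>\<^sub>\<le>\<^sub>0" "e + 1 - a \<notin> \<int>\<^sub>\<le>\<^sub>0" "e + 1 - b \<notin> \<int>\<^sub>\<le>\<^sub>0"
    using nonpos[THEN add_1_notin_nonpos_Ints] by (simp_all add: algebra_simps)
  have w_Suc: "w e (Suc k) = - (a * b / ((e - a) * (e - b))) * (h2 e k * (- 1) ^ k)" for e k
    by (simp add: w_def Y_def h2_def hyper_coeff_def pochhammer_rec mult_ac del: of_nat_Suc)
  have w_0: "w e 0 = 0" for e
    by (simp add: w_def)
  have sums: "(\<lambda>j. h1 e j * (- 1) ^ j + 2 * w e j) sums alternating_dougall_sum a b e"
    if re: "Re (e - 2 * a - 2 * b) > 0" and nonpos: "e - a \<notin> \<int>\<^sub>\<le>\<^sub>0" "e - b \<notin> \<int>\<^sub>\<le>\<^sub>0" for e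
  proof -
    have "(\<lambda>j. h1 e j * (- 1) ^ j) sums hypergeom [e - 1, a, b] [e - a, e - b] (- 1)"
      unfolding h1_def using nonpos re by (intro hyper_coeff_sums) auto
    moreover have "(\<lambda>j. h2 e j * (- 1) ^ j) sums hypergeom [e, a + 1, b + 1] [e - a + 1, e - b + 1] (- 1)"
      unfolding h2_def using nonpos[THEN add_1_notin_nonpos_Ints] re by (intro hyper_coeff_sums) auto
    then have "(\<lambda>k. w e (Suc k)) sums (- (a * b / ((e - a) * (e - b))) *
        hypergeom [e, a + 1, b + 1] [e - a + 1, e - b + 1] (- 1))"
      unfolding w_Suc by (rule sums_mult)
    then have "w e sums (- (a * b / ((e - a) * (e - b))) *
        hypergeom [e, a + 1, b + 1] [e - a + 1, e - b + 1] (- 1))"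
      using w_0 by (auto dest: sums_Suc)
    ultimately have "(\<lambda>j. h1 e j * (- 1) ^ j + 2 * w e j) sums
       (hypergeom [e - 1, a, b] [e - a, e - b] (- 1) + 2 * (- (a * b / ((e - a) * (e - b))) *
        hypergeom [e, a + 1, b + 1] [e - a + 1, e - b + 1] (- 1)))"
      by (intro sums_add sums_mult)
    then show ?thesis by (simp add: alternating_dougall_sum_def mult_ac)
  qed
  \<comment> \<open>The parameter excess of \<open>h2\<close> is \<open>e - 2 * a - 2 * b\<close>,
    so the hypothesis \<open>re\<close> makes this series converge; its terms, and with them
    \<open>G\<close>, tend to 0.\<close>
  have "(\<lambda>k. h2 e k * (- 1) ^ k) sums hypergeom [e, a + 1, b + 1] [e - a + 1, e - b + 1] (- 1)"
    unfolding h2_def using nonpos[THEN add_1_notin_nonpos_Ints] re by (intro hyper_coeff_sums) auto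
  then have "(\<lambda>k. h2 e k * (- 1) ^ k) \<longlonglongrightarrow> 0"
    by (intro summable_LIMSEQ_zero) (rule sums_summable)
  then have "(\<lambda>k. C * X * (h2 e k * (- 1) ^ k)) \<longlonglongrightarrow> C * X * 0"
    by (intro tendsto_intros)
  moreover have "G (Suc k) = C * X * (h2 e k * (- 1) ^ k)" for k
    unfolding G_def w_Suc X_def [symmetric] by simp
  ultimately have "(\<lambda>k. G (Suc k)) \<longlonglongrightarrow> 0"
    by simp
  then have "G \<longlonglongrightarrow> 0"
    by (rule LIMSEQ_imp_Suc)
  then have "(\<lambda>j. G (Suc j) - G j) sums (0 - G 0)"
    by (rule telescope_sums)
  moreover have "G (Suc j) - G j = C * (h1 e j * (- 1) ^ j + 2 * w e j) -
     (e * (e - a - b)) * (h1 (e + 1) j * (- 1) ^ j + 2 * w (e + 1) j)" for j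
  proof (cases j)
    case 0
    have "C \<noteq> 0" using nonpos by (auto simp: C_def)
    then have "G (Suc 0) - G 0 = a * b"
      by (simp add: G_def w_Suc h2_def) (simp add: w_def C_def)
    also have "\<dots> = C - e * (e - a - b)"
      by (simp add: C_def algebra_simps)
    finally show ?thesis using 0 by (simp add: h1_def w_def)
  next
    case (Suc k)
    define J where "J = complex_of_nat j"
    define E where "E = pochhammer e k"
    define Z where "Z = Y e j"
    define D where "D = (e - a + J) * (e - b + J)"
    define N where "N = (a + J) * (b + J)"
    have J: "J = of_nat k + 1" by (simp add: J_def Suc)
    have e0: "e \<noteq> 0" using nonpos by auto
    have D: "D \<noteq> 0" unfolding D_def J_def using nonpos[THEN add_of_nat_neq_0] by simp
    have Yh1: "h1 e j * (- 1) ^ j = pochhammer (e - 1) j * Y e j" for e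
      by (simp add: h1_def hyper_coeff_def Y_def mult_ac)
    have 1: "h1 e j * (- 1) ^ j + 2 * w e j = (e - 1 + 2 * J) * E * Z"
      unfolding Yh1 w_def by (simp add: Suc pochhammer_minus_1_Suc E_def Z_def J algebra_simps)
    have "Y (e + 1) j = Z * (C / D)"
      using nonpos nonpos1 by (simp add: Y_def Z_def C_def D_def pochhammer_shift J_def
          diff_add_eq [symmetric] mult_ac)
    moreover have "pochhammer (e + 1) k = E * (e + J - 1) / e"
      using nonpos by (simp add: pochhammer_shift E_def J)
    moreover have 5: "h1 (e + 1) j * (- 1) ^ j + 2 * w (e + 1) j =
        (e + 2 * J) * pochhammer (e + 1) k * Y (e + 1) j"
      unfolding Yh1 w_def by (simp add: Suc pochhammer_rec [of e] J algebra_simps)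
    ultimately have 2: "h1 (e + 1) j * (- 1) ^ j + 2 * w (e + 1) j =
        (e + 2 * J) * (E * (e + J - 1) / e) * (Z * (C / D))"
      using 5 by simp
    have 3: "w e j = J * E * Z"
      by (simp add: w_def Suc E_def Z_def J)
    have "of_nat (Suc j) * Y e (Suc j) = - (Z * (N / D))"
      by (simp add: Y_def Z_def N_def D_def J_def pochhammer_Suc mult_ac del: of_nat_Suc)
    then have 4: "w e (Suc j) = - (E * (e + J - 1) * (Z * (N / D)))"
      by (simp add: w_def pochhammer_Suc E_def J mult_ac Suc del: of_nat_Suc)
    \<comment> \<open>The certificate equation with the factor \<open>C * E * Z / D\<close>
      removed.\<close>
    have "(e - 1 + 2 * J) * D - (e - a - b) * (e + 2 * J) * (e + J - 1) = (e + J - 1) * N + J * D"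
      unfolding D_def N_def by algebra
    then have "(C * E * Z / D) * ((e - 1 + 2 * J) * D - (e - a - b) * (e + 2 * J) * (e + J - 1)) =
          (C * E * Z / D) * ((e + J - 1) * N + J * D)"
      by simp
    moreover have "(C * E * Z / D) * ((e - 1 + 2 * J) * D - (e - a - b) * (e + 2 * J) * (e + J - 1)) =
        C * ((e - 1 + 2 * J) * E * Z) - (e * (e - a - b)) *
          ((e + 2 * J) * (E * (e + J - 1) / e) * (Z * (C / D)))"
      using D e0 by (simp add: field_simps)
    moreover have "(C * E * Z / D) * ((e + J - 1) * N + J * D) =
       - C * - (E * (e + J - 1) * (Z * (N / D))) - - C * (J * E * Z)"
      using D by (simp add: field_simps)
    ultimately show ?thesis
      unfolding G_def 1 2 unfolding 3 4 by (simp only:)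
  qed
  ultimately have "(\<lambda>j. C * (h1 e j * (- 1) ^ j + 2 * w e j) -
     (e * (e - a - b)) * (h1 (e + 1) j * (- 1) ^ j + 2 * w (e + 1) j)) sums 0"
    by (simp add: G_def w_def)
  moreover have "(\<lambda>j. C * (h1 e j * (- 1) ^ j + 2 * w e j) -
     (e * (e - a - b)) * (h1 (e + 1) j * (- 1) ^ j + 2 * w (e + 1) j)) sums
     (C * alternating_dougall_sum a b e - (e * (e - a - b)) * alternating_dougall_sum a b (e + 1))"
    using nonpos nonpos1 re by (intro sums_diff sums_mult sums) auto
  ultimately have "C * alternating_dougall_sum a b e - (e * (e - a - b)) * alternating_dougall_sum a b (e + 1) = 0"
    using sums_unique2 by blast
  then show ?thesis
    by (simp add: C_def)
qed

text \<open>Iteration in \<open>e\<close>: the coefficient of the second series vanishes in the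
  limit, and \<open>e\<close>, \<open>e - a - b\<close> balance against \<open>e - a\<close>,
  \<open>e - b\<close>.\<close>

theorem alternating_4F3:
  fixes a b e :: complex
  assumes re: "Re (e - 2 * a - 2 * b) > 0"
    and nonpos: "e \<notin> \<int>\<^sub>\<le>\<^sub>0" "e - a \<notin> \<int>\<^sub>\<le>\<^sub>0" "e - b \<notin> \<int>\<^sub>\<le>\<^sub>0"
  shows "alternating_dougall_sum a b e = Gamma (e - a) * Gamma (e - b) / (Gamma e * Gamma (e - a - b))"
proof -
  define S where "S = (\<lambda>n. alternating_dougall_sum a b (e + of_nat n))"
  have shift: "z \<notin> \<int>\<^sub>\<le>\<^sub>0 \<Longrightarrow> z + of_nat n \<notin> \<int>\<^sub>\<le>\<^sub>0" for z :: complex and n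
    using add_of_nat_nonpos_Ints by blast
  have "S = (\<lambda>n. hypergeom [e - 1 + of_nat n, a, b] [e - a + of_nat n, e - b + of_nat n] (- 1)
     - 2 * a * b * ((1 / (e - a + of_nat n)) * (1 / (e - b + of_nat n)))
       * hypergeom [e + of_nat n, a + 1, b + 1]
           [e - a + 1 + of_nat n, e - b + 1 + of_nat n] (- 1))"
    by (simp add: S_def alternating_dougall_sum_def fun_eq_iff algebra_simps)
  also have "\<dots> \<longlonglongrightarrow> 1 - 2 * a * b * (0 * 0) * 1"
    using hypergeom_shift_tendsto_1[of "[a, b]" "[e - b]" "- 1" "e - 1" "e - a"]
      hypergeom_shift_tendsto_1[of "[a + 1, b + 1]" "[e - b + 1]" "- 1" e "e - a + 1"]
    by (intro tendsto_intros inverse_add_of_nat_tendsto_0) simp_all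
  finally have "S \<longlonglongrightarrow> 1" by simp
  moreover have "((e - a + of_nat n) * (e - b + of_nat n)) * S n =
       ((e + of_nat n) * (e - a - b + of_nat n)) * S (Suc n)" for n
  proof -
    have 1: "x + of_nat n - y = x - y + of_nat n" for x y :: complex by simp
    have 3: "e + of_nat (Suc n) = e + of_nat n + 1" by simp
    show ?thesis
      using alternating_dougall_sum_contiguous[of "e + of_nat n" a b] re nonpos[THEN shift, of n]
      unfolding S_def 3 by (simp only: 1) simp
  qed
  moreover have "(e - a + of_nat n) * (e - b + of_nat n) \<noteq> 0" for n
    using nonpos by (auto dest: add_of_nat_neq_0[of _ n])
  ultimately have "(\<lambda>n. (\<Prod>k<n. (e + of_nat k) * (e - a - b + of_nat k)) /
      (\<Prod>k<n. (e - a + of_nat k) * (e - b + of_nat k))) \<longlonglongrightarrow> S 0"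
    by (rule recurrence_limit)
  moreover have "(\<lambda>n. (\<Prod>k<n. (e + of_nat k) * (e - a - b + of_nat k)) /
      (\<Prod>k<n. (e - a + of_nat k) * (e - b + of_nat k))) \<longlonglongrightarrow>
      (rGamma e * rGamma (e - a - b)) / (rGamma (e - a) * rGamma (e - b))"
    using pochhammer_quotient_tendsto[of "[e, e - a - b]" "[e - a, e - b]"] nonpos
    by (simp add: pochhammer_prod prod.distrib atLeast0LessThan)
  ultimately have "S 0 = (rGamma e * rGamma (e - a - b)) / (rGamma (e - a) * rGamma (e - b))"
    by (rule LIMSEQ_unique)
  then show ?thesis
    by (simp add: S_def Gamma_def field_simps)
qed

subsection \<open>A Chu--Vandermonde sum and its consequences\<close>

text \<open>Reversing the factors gives \<open>pochhammer (s + x + m) (n - m)\<close> the base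
  \<open>- v\<close>, with the sign \<open>(-1) ^ (n - m)\<close>; the binomial theorem for rising
  factorials then applies, and \<open>u - v = - x\<close>. The value is the falling factorial
  \<open>x (x - 1) ... (x - n + 1)\<close>, independent of \<open>s\<close>.\<close>

lemma alternating_pochhammer_sum:
  fixes s x :: "'a::comm_ring_1"
  shows "(\<Sum>m\<le>n. (- 1) ^ m * of_nat (n choose m) * pochhammer (s + of_nat n - 1) m *
            pochhammer (s + x + of_nat m) (n - m)) = (- 1) ^ n * pochhammer (- x) n"
proof -
  define u v where "u = s + of_nat n - 1" and "v = s + x + of_nat n - 1"
  have "(- 1) ^ m * of_nat (n choose m) * pochhammer u m * pochhammer (s + x + of_nat m) (n - m) =
     (- 1) ^ n * (of_nat (n choose m) * pochhammer u m * pochhammer (- v) (n - m))"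
    if "m \<le> n" for m
  proof -
    have "v - of_nat (n - m) + 1 = s + x + of_nat m"
      using that by (simp add: v_def of_nat_diff)
    then have 1: "pochhammer (s + x + of_nat m) (n - m) = (- 1) ^ (n - m) * pochhammer (- v) (n - m)"
      using pochhammer_minus'[of v "n - m"] by (simp only:)
    have 2: "(- 1) ^ n = (- 1 :: 'a) ^ m * (- 1) ^ (n - m)"
      using that by (simp flip: power_add)
    show ?thesis
      unfolding 1 2 by (simp only: mult_ac)
  qed
  then have "(\<Sum>m\<le>n. (- 1) ^ m * of_nat (n choose m) * pochhammer u m *
            pochhammer (s + x + of_nat m) (n - m)) =
      (\<Sum>m\<le>n. (- 1) ^ n * (of_nat (n choose m) * pochhammer u m * pochhammer (- v) (n - m)))"
    by (intro sum.cong refl) simp_all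
  also have "\<dots> = (- 1) ^ n * pochhammer (u + - v) n"
    by (simp only: sum_distrib_left pochhammer_binomial_sum)
  also have "u + - v = - x"
    by (simp add: u_def v_def)
  finally show ?thesis
    by (simp add: u_def)
qed

lemma falling_of_nat_eq_0: "N < n \<Longrightarrow> (- 1) ^ n * pochhammer (- of_nat N) n = (0 :: 'a :: idom)"
  by (simp add: pochhammer_of_nat_eq_0_lemma)

lemma pochhammer_of_nat_Suc: "pochhammer (1 + of_nat k) n = (fact (k + n) / fact k :: 'a :: field_char_0)"
proof -
  have "fact (k + n) = (fact k * pochhammer (1 + of_nat k) n :: 'a)"
    unfolding pochhammer_fact by (rule pochhammer_product')
  then show ?thesis by simp
qed

text \<open>Evaluates the falling factorial of order \<open>n\<close> at \<open>N = k + n\<close>,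
  the index that remains once the vanishing terms with \<open>N < n\<close> are dropped.\<close>

lemma falling_of_nat:
  "(- 1) ^ n * pochhammer (- of_nat (k + n)) n = (fact (k + n) / fact k :: 'a :: field_char_0)"
proof -
  have "of_nat (k + n) - of_nat n + 1 = (1 + of_nat k :: 'a)" by simp
  then show ?thesis
    using pochhammer_minus'[of "of_nat (k + n) :: 'a" n] pochhammer_of_nat_Suc[of k n, where 'a = 'a]
    by (simp only:)
qed

section \<open>The finite expansion of a \<open>3F2\<close> at 1\<close>

text \<open>Up to a constant these are the terms, from index \<open>M\<close> on, of the Gauss
  series with \<open>a\<close>, \<open>b\<close>, \<open>c\<close> lowered by \<open>M\<close>. Its
  total is Gauss's value, from which the first \<open>M\<close> terms are subtracted.\<close>

lemma shifted_gauss_sums: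
  fixes a b c :: complex
  assumes re: "Re (c - a - b) > 0" and c: "c - of_nat M \<notin> \<int>\<^sub>\<le>\<^sub>0"
    and ab: "pochhammer (a - of_nat M) M \<noteq> 0" "pochhammer (b - of_nat M) M \<noteq> 0"
  shows "(\<lambda>N. pochhammer a N * pochhammer b N / (pochhammer c N * fact (N + M))) sums
    (pochhammer (c - of_nat M) M / (pochhammer (a - of_nat M) M * pochhammer (b - of_nat M) M) *
      (Gamma (c - of_nat M) * Gamma (c - a - b + of_nat M) * rGamma (c - a) * rGamma (c - b)
       - (\<Sum>k<M. pochhammer (a - of_nat M) k * pochhammer (b - of_nat M) k
            / (fact k * pochhammer (c - of_nat M) k))))"
proof -
  define a' b' c' where "a' = a - of_nat M" and "b' = b - of_nat M" and "c' = c - of_nat M"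
  let ?h = "hyper_coeff [a', b'] [c']"
  have abc: "a = a' + of_nat M" "b = b' + of_nat M" "c = c' + of_nat M"
    by (simp_all add: a'_def b'_def c'_def)
  have re': "Re (c' - a' - b') > 0" using re by (simp add: abc)
  have "?h sums hypergeom [a', b'] [c'] 1"
    using hyper_coeff_sums[of "[a', b']" "[c']" 1] re' c by (simp add: c'_def)
  then have "(\<lambda>N. ?h (N + M)) sums (hypergeom [a', b'] [c'] 1 - (\<Sum>k<M. ?h k))"
    by (rule sums_split_initial_segment)
  then have "(\<lambda>N. pochhammer c' M / (pochhammer a' M * pochhammer b' M) * ?h (N + M)) sums
     (pochhammer c' M / (pochhammer a' M * pochhammer b' M) * (hypergeom [a', b'] [c'] 1 - (\<Sum>k<M. ?h k)))"
    by (rule sums_mult)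
  moreover have "pochhammer c' M / (pochhammer a' M * pochhammer b' M) * ?h (N + M) =
      pochhammer a N * pochhammer b N / (pochhammer c N * fact (N + M))" for N
  proof -
    have "pochhammer a' M \<noteq> 0" "pochhammer b' M \<noteq> 0" "pochhammer c' M \<noteq> 0"
      using ab c by (auto simp: a'_def b'_def c'_def dest: pochhammer_neq_0)
    then show ?thesis
      by (simp add: hyper_coeff_def abc pochhammer_product' add.commute[of N M])
  qed
  moreover have "hypergeom [a', b'] [c'] 1 =
      Gamma c' * Gamma (c - a - b + of_nat M) * rGamma (c - a) * rGamma (c - b)"
  proof -
    have 1: "c' - a' = c - a" "c - a - b' = c - a - b + of_nat M" "c' - b' = c - b"
      by (simp_all add: a'_def b'_def c'_def)
    have "c' \<notin> \<int>\<^sub>\<le>\<^sub>0" using c by (simp add: c'_def)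
    from gauss_hypergeom[OF re' this] show ?thesis
      unfolding 1 .
  qed
  moreover have "?h k = pochhammer a' k * pochhammer b' k / (fact k * pochhammer c' k)" for k
    by (simp add: hyper_coeff_def mult_ac)
  ultimately show ?thesis
    unfolding a'_def [symmetric] b'_def [symmetric] c'_def [symmetric] by simp
qed

text \<open>The \<open>3F2\<close> is, up to a constant, the sum of \<open>B N\<close>, which
  carries the falling factorial of \<open>N\<close> of order \<open>n\<close>. Expanding the latter
  by \<open>alternating_pochhammer_sum\<close> with \<open>s = 1 + m\<close> and
  \<open>x = N\<close> splits the series into \<open>n + 1\<close> sums of the kind in
  \<open>shifted_gauss_sums\<close>, with \<open>M = j + m\<close>.\<close>

lemma hypergeom_3F2_finite_sum:
  fixes a b c :: complex
  assumes re: "Re (c - a - b) > 0"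
    and c: "\<And>k::int. k \<le> int n + int m \<Longrightarrow> c \<noteq> of_int k"
    and ab: "\<And>k::int. - int n + 1 \<le> k \<Longrightarrow> k \<le> int n + int m \<Longrightarrow> a \<noteq> of_int k \<and> b \<noteq> of_int k"
  shows "hypergeom [a + of_nat n, b + of_nat n, 1 + of_nat n]
                [c + of_nat n, 1 + of_nat m + 2 * of_nat n] 1 =
        fact (2 * n + m) * pochhammer c n / (fact n * pochhammer a n * pochhammer b n)
        * (\<Sum>j=0..n. (- 1) ^ j * of_nat (n choose j)
            * (pochhammer (of_nat n + of_nat m) j * pochhammer (c - of_nat j - of_nat m) (j + m)
               / (pochhammer (a - of_nat j - of_nat m) (j + m)
                  * pochhammer (b - of_nat j - of_nat m) (j + m)))
            * (Gamma (c - of_nat j - of_nat m) * Gamma (c - a - b + of_nat m + of_nat j)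
                 * rGamma (c - a) * rGamma (c - b)
               - (\<Sum>k<j + m. pochhammer (a - of_nat m - of_nat j) k
                    * pochhammer (b - of_nat m - of_nat j) k
                    / (fact k * pochhammer (c - of_nat m - of_nat j) k))))" (is "?lhs = ?pref * sum ?f _")
proof -
  define A where "A = (\<lambda>N. pochhammer a N * pochhammer b N / pochhammer c N)"
  define B where "B = (\<lambda>N. A N * ((- 1) ^ n * pochhammer (- of_nat N) n) / fact (N + n + m))"
  have nonpos: "c - of_nat M \<notin> \<int>\<^sub>\<le>\<^sub>0" if "M \<le> n + m" for M
  proof
    assume "c - of_nat M \<in> \<int>\<^sub>\<le>\<^sub>0"
    then obtain k where k: "c - of_nat M = of_int k" "k \<le> 0" by (auto elim!: nonpos_Ints_cases)
    then have "c = of_int (k + int M)" by (simp add: algebra_simps)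
    with c[of "k + int M"] k that show False by auto
  qed
  have c0: "c \<notin> \<int>\<^sub>\<le>\<^sub>0" using nonpos[of 0] by simp
  \<comment> \<open>The zeros of \<open>pochhammer z n\<close> are \<open>-n + 1, ..., 0\<close>,
    those of \<open>pochhammer (z - M) M\<close> are \<open>1, ..., M\<close>; together they give
    the excluded range for \<open>a\<close> and \<open>b\<close>.\<close>
  have poch0: "pochhammer z n \<noteq> 0 \<and> (\<forall>M\<le>n+m. pochhammer (z - of_nat M) M \<noteq> 0)"
    if z: "\<And>k::int. - int n + 1 \<le> k \<Longrightarrow> k \<le> int n + int m \<Longrightarrow> z \<noteq> of_int k" for z :: complex
  proof (intro conjI allI impI notI)
    assume "pochhammer z n = 0"
    then obtain k where "k < n" "z = of_int (- int k)" by (auto simp: pochhammer_eq_0_iff)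
    with z[of "- int k"] show False by auto
  next
    fix M assume M: "M \<le> n + m" "pochhammer (z - of_nat M) M = 0"
    then obtain k where "k < M" "z - of_nat M = - of_nat k" by (auto simp: pochhammer_eq_0_iff)
    then have "z = of_int (int M - int k)" by (simp add: algebra_simps)
    with z[of "int M - int k"] M \<open>k < M\<close> show False by auto
  qed
  have a0: "pochhammer a n \<noteq> 0" "M \<le> n + m \<Longrightarrow> pochhammer (a - of_nat M) M \<noteq> 0"
    and b0: "pochhammer b n \<noteq> 0" "M \<le> n + m \<Longrightarrow> pochhammer (b - of_nat M) M \<noteq> 0" for M
    using poch0[of a] poch0[of b] ab by blast+
  have "(\<lambda>N. (- 1) ^ j * of_nat (n choose j) * pochhammer (of_nat n + of_nat m) j *
            (pochhammer a N * pochhammer b N / (pochhammer c N * fact (N + (j + m))))) sums ?f j"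
    if "j \<in> {0..n}" for j
  proof -
    have 1: "z - of_nat j - of_nat m = z - of_nat (j + m)" "z - of_nat m - of_nat j = z - of_nat (j + m)"
      "z + of_nat m + of_nat j = z + of_nat (j + m)" for z :: complex
      by simp_all
    have "?f j = (- 1) ^ j * of_nat (n choose j) * pochhammer (of_nat n + of_nat m) j *
      (pochhammer (c - of_nat (j + m)) (j + m) / (pochhammer (a - of_nat (j + m)) (j + m) * pochhammer (b - of_nat (j + m)) (j + m)) *
      (Gamma (c - of_nat (j + m)) * Gamma (c - a - b + of_nat (j + m)) * rGamma (c - a) * rGamma (c - b)
       - (\<Sum>k<j + m. pochhammer (a - of_nat (j + m)) k * pochhammer (b - of_nat (j + m)) k
            / (fact k * pochhammer (c - of_nat (j + m)) k))))"
      unfolding 1 by (simp only: times_divide_eq_left times_divide_eq_right mult.assoc)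
    then show ?thesis
      using that by (simp only:) (intro sums_mult shifted_gauss_sums re nonpos a0 b0; simp)
  qed
  then have "(\<lambda>N. \<Sum>j=0..n. (- 1) ^ j * of_nat (n choose j) * pochhammer (of_nat n + of_nat m) j *
            (pochhammer a N * pochhammer b N / (pochhammer c N * fact (N + (j + m))))) sums sum ?f {0..n}"
    by (rule sums_sum)
  moreover have "(\<Sum>j=0..n. (- 1) ^ j * of_nat (n choose j) * pochhammer (of_nat n + of_nat m) j *
            (pochhammer a N * pochhammer b N / (pochhammer c N * fact (N + (j + m))))) = B N" for N
  proof -
    \<comment> \<open>All reciprocal factorials are brought over \<open>fact (N + n + m)\<close>,
      which produces exactly the rising factorials of the Chu--Vandermonde sum.\<close>
    have *: "1 / fact (N + (j + m)) = pochhammer (1 + of_nat m + of_nat N + of_nat j) (n - j) / (fact (N + n + m) :: complex)"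
      if "j \<le> n" for j
    proof -
      have "pochhammer (1 + of_nat (N + (j + m))) (n - j) = (fact (N + (j + m) + (n - j)) / fact (N + (j + m)) :: complex)"
        by (rule pochhammer_of_nat_Suc)
      moreover have "N + (j + m) + (n - j) = N + n + m" using that by simp
      ultimately show ?thesis by (simp add: add_ac)
    qed
    have "B N = A N / fact (N + n + m) * ((- 1) ^ n * pochhammer (- of_nat N) n)"
      by (simp add: B_def)
    also have "\<dots> = (\<Sum>j\<le>n. A N / fact (N + n + m) * ((- 1) ^ j * of_nat (n choose j) * pochhammer (1 + of_nat m + of_nat n - 1) j *
            pochhammer (1 + of_nat m + of_nat N + of_nat j) (n - j)))"
      by (simp only: alternating_pochhammer_sum [symmetric, of n "of_nat N" "1 + of_nat m"] sum_distrib_left)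
    also have "\<dots> = (\<Sum>j\<le>n. (- 1) ^ j * of_nat (n choose j) * pochhammer (of_nat n + of_nat m) j * (A N * (1 / fact (N + (j + m)))))"
    proof (rule sum.cong)
      fix j assume "j \<in> {..n}"
      then have "j \<le> n" by simp
      moreover have "1 + of_nat m + of_nat n - 1 = (of_nat n + of_nat m :: complex)" by simp
      ultimately show "A N / fact (N + n + m) * ((- 1) ^ j * of_nat (n choose j) *
            pochhammer (1 + of_nat m + of_nat n - 1) j * pochhammer (1 + of_nat m + of_nat N + of_nat j) (n - j)) =
          (- 1) ^ j * of_nat (n choose j) * pochhammer (of_nat n + of_nat m) j * (A N * (1 / fact (N + (j + m))))"
        by (simp only: *) (simp only: times_divide_eq_left times_divide_eq_right mult_ac)
    qed simp
    finally show ?thesis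
      by (simp add: A_def atMost_atLeast0)
  qed
  ultimately have "B sums sum ?f {0..n}"
    by simp
  moreover have "B N = 0" if "N < n" for N
    using falling_of_nat_eq_0[OF that, where 'a = complex] by (simp add: B_def)
  ultimately have "(\<lambda>k. B (k + n)) sums sum ?f {0..n}"
    by (subst sums_zero_iff_shift)
  then have "(\<lambda>k. ?pref * B (k + n)) sums (?pref * sum ?f {0..n})"
    by (rule sums_mult)
  \<comment> \<open>At \<open>N = k + n\<close> the falling factorial is
    \<open>fact (k + n) / fact k\<close>, which gives the upper parameter \<open>1 + n\<close>;
    \<open>fact (2 * n + m + k)\<close> gives the lower parameter
    \<open>1 + m + 2 * n\<close>.\<close>
  moreover have "?pref * B (k + n) =
      hyper_coeff [a + of_nat n, b + of_nat n, 1 + of_nat n] [c + of_nat n, 1 + of_nat m + 2 * of_nat n] k" for k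
  proof -
    have "pochhammer (1 + of_nat (2 * n + m)) k = (fact (2 * n + m + k) / fact (2 * n + m) :: complex)"
      by (rule pochhammer_of_nat_Suc)
    then have 1: "pochhammer (1 + of_nat m + 2 * of_nat n) k = (fact (2 * n + m + k) / fact (2 * n + m) :: complex)"
      by (simp add: add_ac)
    have 2: "k + n + n + m = 2 * n + m + k" by simp
    have "pochhammer c n \<noteq> 0" using c0 by (rule pochhammer_neq_0)
    then show ?thesis
      unfolding B_def A_def falling_of_nat 2 hyper_coeff_def
      using a0(1) b0(1)
      by (simp add: 1 pochhammer_of_nat_Suc pochhammer_product' add.commute[of k n]) (simp add: mult_ac)
  qed
  ultimately have "?lhs = ?pref * sum ?f {0..n}"
    by (simp add: hypergeom_conv_hyper_coeff sums_iff)
  then show ?thesis .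
qed

section \<open>Moments of Jacobi polynomials against the Beta density, and the integrals\<close>

text \<open>The monomials only raise the two Beta parameters, so the integral is a quotient of Beta
  values.\<close>

lemma has_bochner_integral_beta_monomial:
  assumes "p > 0" "q > 0"
  shows "has_bochner_integral lborel (\<lambda>x. indicator {0..1} x *\<^sub>R (x ^ i * (1 - x) ^ m * beta_density p q x))
     (pochhammer p i * pochhammer q m / pochhammer (p + q) (i + m))"
proof -
  let ?g = "\<lambda>x::real. x powr (p + real i - 1) * (1 - x) powr (q + real m - 1)"
  have pos: "p + real i > 0" "q + real m > 0" using assms by simp_all
  have int: "set_integrable lborel {0..1} ?g"
    by (rule integrable_Beta[OF pos])
  have val: "(LINT x:{0..1}|lborel. ?g x) = Beta (p + real i) (q + real m)"
    using set_borel_integral_eq_integral(2)[OF int] integral_unique[OF has_integral_Beta_real[OF pos]]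
    by simp
  \<comment> \<open>At \<open>y = 0\<close> both sides are 0, because \<open>powr\<close> has the
    value 0 at base 0 for every exponent.\<close>
  have pow: "y ^ k * y powr (r - 1) = y powr (r + real k - 1)" if "y \<ge> 0" for y r :: real and k
  proof (cases "y = 0")
    case False
    with that show ?thesis
      by (simp add: powr_realpow [symmetric] powr_add [symmetric] algebra_simps)
  qed simp
  have "has_bochner_integral lborel (\<lambda>x. (indicator {0..1} x *\<^sub>R ?g x) / Beta p q)
          (Beta (p + real i) (q + real m) / Beta p q)"
    using int val unfolding set_integrable_def set_lebesgue_integral_def
    by (intro has_bochner_integral_divide_zero) (simp add: has_bochner_integral_iff)
  also have "(\<lambda>x. (indicator {0..1} x *\<^sub>R ?g x) / Beta p q) =
      (\<lambda>x. indicator {0..1} x *\<^sub>R (x ^ i * (1 - x) ^ m * beta_density p q x))"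
    by (auto simp: fun_eq_iff indicator_def beta_density_def pow [symmetric])
  also have "Beta (p + real i) (q + real m) / Beta p q =
      pochhammer p i * pochhammer q m / pochhammer (p + q) (i + m)"
  proof -
    have nonpos: "z \<notin> \<int>\<^sub>\<le>\<^sub>0" if "z > 0" for z :: real
      using that by (auto elim!: nonpos_Ints_cases)
    have "Gamma (p + q) \<noteq> 0" "Gamma (p + real i + (q + real m)) \<noteq> 0"
      using nonpos[of "p + q"] nonpos[of "p + real i + (q + real m)"] assms by (auto simp: Gamma_eq_zero_iff)
    then show ?thesis
      using assms nonpos by (simp add: Beta_def pochhammer_Gamma add_ac)
  qed
  finally show ?thesis .
qed

text \<open>Expanding in powers of \<open>1 - x\<close> reduces the moment to
  \<open>alternating_pochhammer_sum\<close> with \<open>s = f + d\<close> and \<open>x = i\<close>.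
  The last factor is the falling factorial of \<open>i\<close> of order \<open>j\<close>, so the
  moments with \<open>i < j\<close> vanish: the orthogonality of the Jacobi polynomials.\<close>

lemma has_bochner_integral_jacobi_moment:
  assumes f: "f > 0" and d: "d > 0"
  shows "has_bochner_integral lborel (\<lambda>x. indicator {0..1} x *\<^sub>R (x ^ i * (jacobi_K j f d x * beta_density f d x)))
     (pochhammer f i * pochhammer d j / (fact j * pochhammer (f + d) (i + j)) * ((- 1) ^ j * pochhammer (- real i) j))"
proof -
  define C where "C = (\<lambda>m. (- 1) ^ m * of_nat (j choose m) * pochhammer (f + d + of_nat j - 1) m *
        pochhammer (d + of_nat m) (j - m) / fact j)"
  have "has_bochner_integral lborel (\<lambda>x. \<Sum>m\<le>j. C m * (indicator {0..1} x *\<^sub>R (x ^ i * (1 - x) ^ m * beta_density f d x)))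
     (\<Sum>m\<le>j. C m * (pochhammer f i * pochhammer d m / pochhammer (f + d) (i + m)))"
    by (intro has_bochner_integral_sum has_bochner_integral_mult_right has_bochner_integral_beta_monomial f d)
  also have "(\<lambda>x. \<Sum>m\<le>j. C m * (indicator {0..1} x *\<^sub>R (x ^ i * (1 - x) ^ m * beta_density f d x))) =
     (\<lambda>x. indicator {0..1} x *\<^sub>R (x ^ i * (jacobi_K j f d x * beta_density f d x)))"
  proof
    fix x :: real
    have "C m * (1 - x) ^ m = of_nat (j choose m) * pochhammer (f + d + of_nat j - 1) m *
        pochhammer (d + of_nat m) (j - m) * (x - 1) ^ m / fact j" for m
      by (simp add: C_def power_mult_distrib [symmetric])
    then have "jacobi_K j f d x = (\<Sum>m\<le>j. C m * (1 - x) ^ m)"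
      by (simp add: jacobi_K_def sum_distrib_left atMost_atLeast0 mult_ac)
    then show "(\<Sum>m\<le>j. C m * (indicator {0..1} x *\<^sub>R (x ^ i * (1 - x) ^ m * beta_density f d x))) =
       indicator {0..1} x *\<^sub>R (x ^ i * (jacobi_K j f d x * beta_density f d x))"
      by (simp add: sum_distrib_left sum_distrib_right mult_ac)
  qed
  also have "(\<Sum>m\<le>j. C m * (pochhammer f i * pochhammer d m / pochhammer (f + d) (i + m))) =
     (\<Sum>m\<le>j. pochhammer f i * pochhammer d j / (fact j * pochhammer (f + d) (i + j)) *
       ((- 1) ^ m * of_nat (j choose m) * pochhammer (f + d + of_nat j - 1) m *
          pochhammer (f + d + of_nat i + of_nat m) (j - m)))"
  proof (rule sum.cong)
    fix m assume "m \<in> {..j}"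
    then have m: "m \<le> j" by simp
    \<comment> \<open>Splitting the full Pochhammer symbols at \<open>m\<close> makes everything but
      the alternating summand independent of \<open>m\<close>.\<close>
    have 1: "pochhammer d j = pochhammer d m * pochhammer (d + of_nat m) (j - m)"
      using m by (rule pochhammer_product)
    have 2: "pochhammer (f + d) (i + j) = pochhammer (f + d) (i + m) * pochhammer (f + d + of_nat i + of_nat m) (j - m)"
      using pochhammer_product[of "i + m" "i + j" "f + d"] m by (simp add: add_ac)
    have 3: "pochhammer (f + d) (i + m) > 0" "pochhammer (f + d + of_nat i + of_nat m) (j - m) > 0"
      using f d by (auto intro!: pochhammer_pos add_pos_nonneg)
    show "C m * (pochhammer f i * pochhammer d m / pochhammer (f + d) (i + m)) =
       pochhammer f i * pochhammer d j / (fact j * pochhammer (f + d) (i + j)) *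
       ((- 1) ^ m * of_nat (j choose m) * pochhammer (f + d + of_nat j - 1) m *
          pochhammer (f + d + of_nat i + of_nat m) (j - m))"
      unfolding C_def 1 2 using 3 by simp
  qed simp
  also have "\<dots> = pochhammer f i * pochhammer d j / (fact j * pochhammer (f + d) (i + j)) *
      ((- 1) ^ j * pochhammer (- real i) j)"
    by (subst alternating_pochhammer_sum [symmetric, of _ _ "f + d"]) (simp add: sum_distrib_left)
  finally show ?thesis .
qed

text \<open>The series is integrated term by term: its coefficients are absolutely summable, and
  powers of \<open>x\<close> are bounded by 1 on the interval. The first \<open>j\<close> moments
  vanish, and reindexing the rest by \<open>i = k + j\<close> yields the \<open>3F2\<close>.\<close>

lemma hypergeom_jacobi_integral:
  fixes f d :: real and a b c :: complex
  assumes f: "f > 0" and d: "d > 0" and re: "Re (c - a - b) > 0" and c: "c \<notin> \<int>\<^sub>\<le>\<^sub>0"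
  shows "set_integrable lborel {0..1}
        (\<lambda>x. hypergeom [a, b] [c] (of_real x) * of_real (jacobi_K j f d x) * of_real (beta_density f d x))"
      (is "set_integrable _ _ ?g")
    and "(LBINT x:{0..1}. hypergeom [a, b] [c] (of_real x) * of_real (jacobi_K j f d x)
              * of_real (beta_density f d x)) =
        pochhammer (of_real f) j * pochhammer (of_real d) j * pochhammer a j * pochhammer b j
        / (fact j * pochhammer (of_real f + of_real d) (2 * j) * pochhammer c j)
        * hypergeom [a + of_nat j, b + of_nat j, of_real f + of_nat j]
                    [c + of_nat j, of_real d + of_real f + 2 * of_nat j] 1"
      (is "_ = ?pref * hypergeom ?as ?bs 1")
proof -
  define t where "t = hyper_coeff [a, b] [c]"
  define P where "P = (\<lambda>x. jacobi_K j f d x * beta_density f d x)"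
  define \<mu> where "\<mu> = (\<lambda>i. pochhammer f i * pochhammer d j / (fact j * pochhammer (f + d) (i + j)) *
    ((- 1) ^ j * pochhammer (- real i) j))"
  define F where "F = (\<lambda>i x. t i * complex_of_real (indicator {0..1} x *\<^sub>R (x ^ i * P x)))"
  have moment: "has_bochner_integral lborel (\<lambda>x. indicator {0..1} x *\<^sub>R (x ^ i * P x)) (\<mu> i)" for i
    unfolding P_def \<mu>_def by (rule has_bochner_integral_jacobi_moment[OF f d])
  have F: "has_bochner_integral lborel (F i) (t i * of_real (\<mu> i))" for i
    unfolding F_def by (intro has_bochner_integral_mult_right has_bochner_integral_of_real moment)
  have t: "summable (\<lambda>i. norm (t i))"
    unfolding t_def using re c by (intro summable_hyper_coeff) auto
  \<comment> \<open>The majorant \<open>norm (t i)\<close> times the fixed integrable function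
    \<open>P\<close> gives both pointwise and integrated summability.\<close>
  have le: "norm (F i x) \<le> norm (t i) * norm (indicator {0..1} x *\<^sub>R P x)" for i x
    unfolding F_def norm_mult norm_of_real
    by (intro mult_left_mono) (auto simp: indicator_def abs_mult power_abs intro!: mult_left_le_one_le power_le_one)
  have intF: "integrable lborel (F i)" for i
    using F by (auto simp: has_bochner_integral_iff)
  have P: "integrable lborel (\<lambda>x. indicator {0..1} x *\<^sub>R P x)"
    using moment[of 0] by (auto simp: has_bochner_integral_iff)
  have summable: "summable (\<lambda>i. norm (F i x))" for x
    by (rule summable_comparison_test'[OF summable_mult2[OF t]]) (use le in auto)
  have summable_int: "summable (\<lambda>i. LINT x|lborel. norm (F i x))"
  proof (rule summable_comparison_test'[OF summable_mult2[OF t]])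
    fix i
    have "(LINT x|lborel. norm (F i x)) \<le> (LINT x|lborel. norm (t i) * norm (indicator {0..1} x *\<^sub>R P x))"
      using le by (intro integral_mono integrable_norm intF integrable_mult_right P)
    then show "norm (LINT x|lborel. norm (F i x)) \<le> norm (t i) * (LINT x|lborel. norm (indicator {0..1} x *\<^sub>R P x))"
      by simp
  qed
  have eq: "(\<Sum>i. F i x) = indicator {0..1} x *\<^sub>R ?g x" for x
  proof (cases "x \<in> {0..1}")
    case True
    have "(\<lambda>i. t i * of_real x ^ i) sums hypergeom [a, b] [c] (of_real x)"
      unfolding t_def using True re c by (intro hyper_coeff_sums) auto
    then have "(\<lambda>i. t i * of_real x ^ i * of_real (P x)) sums (hypergeom [a, b] [c] (of_real x) * of_real (P x))"
      by (rule sums_mult2)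
    then show ?thesis
      using True by (simp add: F_def P_def sums_iff mult.assoc)
  qed (simp add: F_def)
  have "integrable lborel (\<lambda>x. \<Sum>i. F i x)"
    by (rule integrable_suminf[OF intF _ summable_int]) (simp add: summable)
  then show "set_integrable lborel {0..1} ?g"
    by (simp add: eq set_integrable_def)
  have "(\<lambda>i. integral\<^sup>L lborel (F i)) sums (LINT x|lborel. (\<Sum>i. F i x))"
    by (rule sums_integral[OF intF _ summable_int]) (simp add: summable)
  then have "(\<lambda>i. t i * of_real (\<mu> i)) sums (LBINT x:{0..1}. ?g x)"
    using F by (simp add: eq set_lebesgue_integral_def has_bochner_integral_iff)
  moreover have "t i * of_real (\<mu> i) = 0" if "i < j" for i
    using falling_of_nat_eq_0[OF that, where 'a = real] by (simp add: \<mu>_def)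
  ultimately have "(\<lambda>k. t (k + j) * of_real (\<mu> (k + j))) sums (LBINT x:{0..1}. ?g x)"
    by (subst sums_zero_iff_shift)
  moreover have "t (k + j) * of_real (\<mu> (k + j)) = ?pref * hyper_coeff ?as ?bs k" for k
  proof -
    have "\<mu> (k + j) = pochhammer f (k + j) * pochhammer d j / (fact j * pochhammer (f + d) (2 * j + k)) *
            (fact (k + j) / fact k)"
      unfolding \<mu>_def falling_of_nat by (simp add: mult_2 add_ac)
    moreover have "pochhammer (f + d) (2 * j + k) = pochhammer (f + d) (2 * j) * pochhammer (f + d + 2 * of_nat j) k"
      using pochhammer_product'[of "f + d" "2 * j" k] by simp
    moreover have 1: "complex_of_real d + of_real f = of_real f + of_real d"
      by simp
    ultimately show ?thesis
      unfolding 1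
      by (simp add: t_def hyper_coeff_def pochhammer_product' add.commute[of k j] pochhammer_of_real [symmetric] mult_ac)
  qed
  ultimately have "(\<lambda>k. ?pref * hyper_coeff ?as ?bs k) sums (LBINT x:{0..1}. ?g x)"
    by simp
  \<comment> \<open>The parameter excess of the \<open>3F2\<close> is \<open>c - a - b + d\<close>,
    with positive real part.\<close>
  moreover have "(\<lambda>k. ?pref * hyper_coeff ?as ?bs k) sums (?pref * hypergeom ?as ?bs 1)"
  proof -
    have "c + of_nat j \<notin> \<int>\<^sub>\<le>\<^sub>0" using c add_of_nat_nonpos_Ints by blast
    moreover have "complex_of_real d + of_real f + 2 * of_nat j \<notin> \<int>\<^sub>\<le>\<^sub>0"
      using f d by (intro Re_pos_notin_nonpos_Ints) simp
    ultimately show ?thesis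
      using hyper_coeff_sums[of ?as ?bs 1] re d by (intro sums_mult) simp
  qed
  ultimately show "(LBINT x:{0..1}. ?g x) = ?pref * hypergeom ?as ?bs 1"
    by (rule sums_unique2)
qed

text \<open>For \<open>f = c\<close> the parameter \<open>c + j\<close> cancels above and below, and
  the \<open>3F2\<close> becomes a Gauss series with excess \<open>e - a - b\<close>, whatever
  \<open>j\<close> is.\<close>

lemma hypergeom_jacobi_integral_same:
  fixes c d :: real and a b :: complex
  assumes c: "c > 0" and d: "d > 0" and re: "Re (of_real c - a - b) > 0"
    and nonpos: "of_real c + of_real d - a \<notin> \<int>\<^sub>\<le>\<^sub>0" "of_real c + of_real d - b \<notin> \<int>\<^sub>\<le>\<^sub>0"
  shows "(LBINT x:{0..1}. hypergeom [a, b] [of_real c] (of_real x) * of_real (jacobi_K j c d x)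
              * of_real (beta_density c d x)) =
        pochhammer (of_real d) j * pochhammer a j * pochhammer b j
        / (fact j * pochhammer (of_real d + of_real c - a) j
                  * pochhammer (of_real d + of_real c - b) j)
        * (Gamma (of_real c + of_real d) * Gamma (of_real d + of_real c - a - b)
           / (Gamma (of_real d + of_real c - a) * Gamma (of_real d + of_real c - b)))"
proof -
  define e where "e = complex_of_real d + of_real c"
  have cj: "complex_of_real c + of_nat k \<notin> \<int>\<^sub>\<le>\<^sub>0" for k
    using c by (intro Re_pos_notin_nonpos_Ints) simp
  have c0: "complex_of_real c \<notin> \<int>\<^sub>\<le>\<^sub>0"
    using cj[of 0] by simp
  have e: "e \<notin> \<int>\<^sub>\<le>\<^sub>0" "e + 2 * of_nat j \<notin> \<int>\<^sub>\<le>\<^sub>0"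
    using c d by (auto intro!: Re_pos_notin_nonpos_Ints simp: e_def)
  have nonpos': "e - a \<notin> \<int>\<^sub>\<le>\<^sub>0" "e - b \<notin> \<int>\<^sub>\<le>\<^sub>0"
    using nonpos by (simp_all add: e_def add.commute)
  have "hypergeom [a + of_nat j, b + of_nat j, of_real c + of_nat j] [of_real c + of_nat j, e + 2 * of_nat j] 1 =
      hypergeom [a + of_nat j, b + of_nat j] [e + 2 * of_nat j] 1"
    unfolding hypergeom_conv_hyper_coeff hyper_coeff_def using pochhammer_neq_0[OF cj] by simp
  also have "\<dots> = Gamma (e + 2 * of_nat j) * Gamma (e + 2 * of_nat j - (a + of_nat j) - (b + of_nat j)) *
      rGamma (e + 2 * of_nat j - (a + of_nat j)) * rGamma (e + 2 * of_nat j - (b + of_nat j))"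
    using re d e(2) by (intro gauss_hypergeom) (simp_all add: e_def)
  also have "e + 2 * of_nat j - (a + of_nat j) - (b + of_nat j) = e - a - b" by simp
  also have "e + 2 * of_nat j - (a + of_nat j) = e - a + of_nat j" by simp
  also have "e + 2 * of_nat j - (b + of_nat j) = e - b + of_nat j" by simp
  \<comment> \<open>The factor \<open>pochhammer e (2 * j)\<close> split off here cancels against
    the denominator of the general formula, just as the two symbols of \<open>c\<close>
    cancel.\<close>
  also have "Gamma (e + 2 * of_nat j) = pochhammer e (2 * j) * Gamma e"
    using e(1) by (simp add: pochhammer_Gamma Gamma_eq_zero_iff)
  also have "rGamma (e - a + of_nat j) = 1 / (pochhammer (e - a) j * Gamma (e - a))"
    using nonpos' by (simp add: pochhammer_Gamma Gamma_eq_zero_iff rGamma_inverse_Gamma divide_inverse)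
  also have "rGamma (e - b + of_nat j) = 1 / (pochhammer (e - b) j * Gamma (e - b))"
    using nonpos' by (simp add: pochhammer_Gamma Gamma_eq_zero_iff rGamma_inverse_Gamma divide_inverse)
  finally have *: "hypergeom [a + of_nat j, b + of_nat j, of_real c + of_nat j] [of_real c + of_nat j, e + 2 * of_nat j] 1 =
      pochhammer e (2 * j) * Gamma e * Gamma (e - a - b) / (pochhammer (e - a) j * Gamma (e - a) * (pochhammer (e - b) j * Gamma (e - b)))"
    by simp
  have "complex_of_real c + of_real d = e" by (simp add: e_def)
  with hypergeom_jacobi_integral(2)[OF c d re c0, of j] show ?thesis
    unfolding e_def [symmetric] *
    using pochhammer_neq_0[OF c0] pochhammer_neq_0[OF e(1)] by (simp add: mult_ac)
qed

text \<open>Integrability is asserted along with each value, since the integral of a non-integrable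
  function is 0 by convention. \<open>rGamma\<close> expresses that reciprocal Gamma values at poles
  are 0.\<close>

theorem corollary4:
  shows
  "(\<forall>(f::real) (d::real) (a::complex) (b::complex) (c::complex) (j::nat).
      f > 0 \<and> d > 0 \<and> Re (c - a - b) > 0 \<and> c \<notin> \<int>\<^sub>\<le>\<^sub>0 \<longrightarrow>
      set_integrable lborel {0..1}
        (\<lambda>x. hypergeom [a, b] [c] (of_real x) * of_real (jacobi_K j f d x)
              * of_real (beta_density f d x)) \<and>
      (LBINT x:{0..1}. hypergeom [a, b] [c] (of_real x) * of_real (jacobi_K j f d x)
              * of_real (beta_density f d x)) =
        pochhammer (of_real f) j * pochhammer (of_real d) j * pochhammer a j * pochhammer b j
        / (fact j * pochhammer (of_real f + of_real d) (2 * j) * pochhammer c j)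
        * hypergeom [a + of_nat j, b + of_nat j, of_real f + of_nat j]
                    [c + of_nat j, of_real d + of_real f + 2 * of_nat j] 1)
   \<and>
   (\<forall>(c::real) (d::real) (a::complex) (b::complex) (j::nat).
      c > 0 \<and> d > 0 \<and> Re (of_real c - a - b) > 0 \<and>
      of_real c + of_real d - a \<notin> \<int>\<^sub>\<le>\<^sub>0 \<and> of_real c + of_real d - b \<notin> \<int>\<^sub>\<le>\<^sub>0 \<longrightarrow>
      set_integrable lborel {0..1}
        (\<lambda>x. hypergeom [a, b] [of_real c] (of_real x) * of_real (jacobi_K j c d x)
              * of_real (beta_density c d x)) \<and>
      (LBINT x:{0..1}. hypergeom [a, b] [of_real c] (of_real x) * of_real (jacobi_K j c d x)
              * of_real (beta_density c d x)) =
        pochhammer (of_real d) j * pochhammer a j * pochhammer b j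
        / (fact j * pochhammer (of_real d + of_real c - a) j
                  * pochhammer (of_real d + of_real c - b) j)
        * (Gamma (of_real c + of_real d) * Gamma (of_real d + of_real c - a - b)
           / (Gamma (of_real d + of_real c - a) * Gamma (of_real d + of_real c - b))))
   \<and>
   (\<forall>(a::complex) (b::complex) (c::complex) (d::complex).
      Re (c - a - b) > 0 \<and> c \<notin> \<int>\<^sub>\<le>\<^sub>0 \<and> c + d \<notin> \<int>\<^sub>\<le>\<^sub>0 \<and> c + d - a \<notin> \<int>\<^sub>\<le>\<^sub>0 \<and>
      c + d - b \<notin> \<int>\<^sub>\<le>\<^sub>0 \<and> c + d - a - b \<notin> \<int>\<^sub>\<le>\<^sub>0 \<longrightarrow>
      Gamma c * Gamma (c - a - b) * Gamma (c + d - a) * Gamma (c + d - b)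
        * rGamma (c - a) * rGamma (c - b) / (Gamma (c + d) * Gamma (c + d - a - b)) =
        hypergeom [a, b, d, c + d - 1] [c, c + d - a, c + d - b] 1
        + 2 * a * b * d / (c * (c + d - a) * (c + d - b))
          * hypergeom [a + 1, b + 1, d + 1, c + d] [c + 1, c + d - a + 1, c + d - b + 1] 1 \<and>
      (Re (c + d - 2 * a - 2 * b) > 0 \<longrightarrow>
       Gamma (c + d - a) * Gamma (c + d - b) / (Gamma (c + d) * Gamma (c + d - a - b)) =
         hypergeom [a, b, c + d - 1] [c + d - a, c + d - b] (- 1)
         - 2 * a * b / ((c + d - a) * (c + d - b))
           * hypergeom [a + 1, b + 1, c + d] [c + d - a + 1, c + d - b + 1] (- 1)))
   \<and>
   (\<forall>(n::nat) (m::nat) (a::complex) (b::complex) (c::complex).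
      Re (c - a - b) > 0 \<and>
      (\<forall>k::int. k \<le> int n + int m \<longrightarrow> c \<noteq> of_int k) \<and>
      (\<forall>k::int. - int n + 1 \<le> k \<and> k \<le> int n + int m \<longrightarrow> a \<noteq> of_int k \<and> b \<noteq> of_int k) \<longrightarrow>
      hypergeom [a + of_nat n, b + of_nat n, 1 + of_nat n]
                [c + of_nat n, 1 + of_nat m + 2 * of_nat n] 1 =
        fact (2 * n + m) * pochhammer c n / (fact n * pochhammer a n * pochhammer b n)
        * (\<Sum>j=0..n. (- 1) ^ j * of_nat (n choose j)
            * (pochhammer (of_nat n + of_nat m) j * pochhammer (c - of_nat j - of_nat m) (j + m)
               / (pochhammer (a - of_nat j - of_nat m) (j + m)
                  * pochhammer (b - of_nat j - of_nat m) (j + m)))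
            * (Gamma (c - of_nat j - of_nat m) * Gamma (c - a - b + of_nat m + of_nat j)
                 * rGamma (c - a) * rGamma (c - b)
               - (\<Sum>k<j + m. pochhammer (a - of_nat m - of_nat j) k
                    * pochhammer (b - of_nat m - of_nat j) k
                    / (fact k * pochhammer (c - of_nat m - of_nat j) k)))))"
proof (intro conjI allI impI; (elim conjE)?)
  fix f d :: real and a b c :: complex and j :: nat
  assume *: "f > 0" "d > 0" "Re (c - a - b) > 0" "c \<notin> \<int>\<^sub>\<le>\<^sub>0"
  show "set_integrable lborel {0..1}
        (\<lambda>x. hypergeom [a, b] [c] (of_real x) * of_real (jacobi_K j f d x)
              * of_real (beta_density f d x))"
    using * by (rule hypergeom_jacobi_integral(1))
  show "(LBINT x:{0..1}. hypergeom [a, b] [c] (of_real x) * of_real (jacobi_K j f d x)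
              * of_real (beta_density f d x)) =
        pochhammer (of_real f) j * pochhammer (of_real d) j * pochhammer a j * pochhammer b j
        / (fact j * pochhammer (of_real f + of_real d) (2 * j) * pochhammer c j)
        * hypergeom [a + of_nat j, b + of_nat j, of_real f + of_nat j]
                    [c + of_nat j, of_real d + of_real f + 2 * of_nat j] 1"
    using * by (rule hypergeom_jacobi_integral(2))
next
  fix c d :: real and a b :: complex and j :: nat
  assume *: "c > 0" "d > 0" "Re (of_real c - a - b) > 0"
    and nonpos: "of_real c + of_real d - a \<notin> \<int>\<^sub>\<le>\<^sub>0" "of_real c + of_real d - b \<notin> \<int>\<^sub>\<le>\<^sub>0"
  have "complex_of_real c \<notin> \<int>\<^sub>\<le>\<^sub>0"
    using *(1) by (intro Re_pos_notin_nonpos_Ints) simp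
  with * show "set_integrable lborel {0..1}
        (\<lambda>x. hypergeom [a, b] [of_real c] (of_real x) * of_real (jacobi_K j c d x)
              * of_real (beta_density c d x))"
    by (rule hypergeom_jacobi_integral(1))
  show "(LBINT x:{0..1}. hypergeom [a, b] [of_real c] (of_real x) * of_real (jacobi_K j c d x)
              * of_real (beta_density c d x)) =
        pochhammer (of_real d) j * pochhammer a j * pochhammer b j
        / (fact j * pochhammer (of_real d + of_real c - a) j
                  * pochhammer (of_real d + of_real c - b) j)
        * (Gamma (of_real c + of_real d) * Gamma (of_real d + of_real c - a - b)
           / (Gamma (of_real d + of_real c - a) * Gamma (of_real d + of_real c - b)))"
    using * nonpos by (rule hypergeom_jacobi_integral_same)
next
  fix a b c d :: complex
  assume *: "Re (c - a - b) > 0" "c \<notin> \<int>\<^sub>\<le>\<^sub>0" "c + d \<notin> \<int>\<^sub>\<le>\<^sub>0" "c + d - a \<notin> \<int>\<^sub>\<le>\<^sub>0" "c + d - b \<notin> \<int>\<^sub>\<le>\<^sub>0"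
  \<comment> \<open>Only the order of the parameters differs from \<open>dougall_sum\<close>; the
    products in the coefficients commute.\<close>
  have "hypergeom [c + d - 1, a, b, d] [c + d - a, c, c + d - b] 1 =
          hypergeom [a, b, d, c + d - 1] [c, c + d - a, c + d - b] 1"
    and "hypergeom [c + d, a + 1, b + 1, d + 1] [c + d - a + 1, c + 1, c + d - b + 1] 1 =
          hypergeom [a + 1, b + 1, d + 1, c + d] [c + 1, c + d - a + 1, c + d - b + 1] 1"
    by (simp_all add: hypergeom_altdef mult_ac)
  with dougall_5F4[OF *]
  show "Gamma c * Gamma (c - a - b) * Gamma (c + d - a) * Gamma (c + d - b)
        * rGamma (c - a) * rGamma (c - b) / (Gamma (c + d) * Gamma (c + d - a - b)) =
        hypergeom [a, b, d, c + d - 1] [c, c + d - a, c + d - b] 1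
        + 2 * a * b * d / (c * (c + d - a) * (c + d - b))
          * hypergeom [a + 1, b + 1, d + 1, c + d] [c + 1, c + d - a + 1, c + d - b + 1] 1"
    by (simp only: dougall_sum_def)
next
  fix a b c d :: complex
  assume *: "c + d \<notin> \<int>\<^sub>\<le>\<^sub>0" "c + d - a \<notin> \<int>\<^sub>\<le>\<^sub>0" "c + d - b \<notin> \<int>\<^sub>\<le>\<^sub>0"
    and re: "Re (c + d - 2 * a - 2 * b) > 0"
  have "hypergeom [c + d - 1, a, b] [c + d - a, c + d - b] (- 1) =
          hypergeom [a, b, c + d - 1] [c + d - a, c + d - b] (- 1)"
    and "hypergeom [c + d, a + 1, b + 1] [c + d - a + 1, c + d - b + 1] (- 1) =
          hypergeom [a + 1, b + 1, c + d] [c + d - a + 1, c + d - b + 1] (- 1)"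
    by (simp_all add: hypergeom_altdef mult_ac)
  with alternating_4F3[OF re *]
  show "Gamma (c + d - a) * Gamma (c + d - b) / (Gamma (c + d) * Gamma (c + d - a - b)) =
         hypergeom [a, b, c + d - 1] [c + d - a, c + d - b] (- 1)
         - 2 * a * b / ((c + d - a) * (c + d - b))
           * hypergeom [a + 1, b + 1, c + d] [c + d - a + 1, c + d - b + 1] (- 1)"
    by (simp only: alternating_dougall_sum_def)
qed (rule hypergeom_3F2_finite_sum; blast)

end
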